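(* For every mesh parameter $h>0$, every time step $\tau>0$, and every value of the model parameter $\varepsilon>0$, the scheme consisting of the first-step problem and the multistep problem is uniquely solvable. That is: (i) given $\phi_h^0,\mu_h^0\in S_h$, there is exactly one pair $(\phi_h^1,\mu_h^{1/2})\in S_h\times S_h$ such that for all $\nu,\psi\in S_h$ $$\Big(\tfrac{\phi_h^1-\phi_h^0}{\tau},\nu\Big)+\varepsilon\,a(\mu_h^{1/2},\nu)=0,$$ $$\varepsilon^{-1}\big(\chi(\phi_h^1,\phi_h^0),\psi\big)-\varepsilon^{-1}(\phi_h^0,\psi)+\tfrac{\tau}{2}a(\mu_h^0,\psi)+\varepsilon\,a\big(\tfrac12\phi_h^1+\tfrac12\phi_h^0,\psi\big)-(\mu_h^{1/2},\psi)=0;$$ and (ii) for every $1\le m\le M-1$, given $\phi_h^m,\phi_h^{m-1}\in S_h$, there is exactly one pair $(\phi_h^{m+1},\mu_h^{m+1/2})\in S_h\times S_h$ such that for all $\nu,\psi\in S_h$ $$\Big(\tfrac{\phi_h^{m+1}-\phi_h^m}{\tau},\nu\Big)+\varepsilon\,a(\mu_h^{m+1/2},\nu)=0,$$ $$\varepsilon^{-1}\big(\chi(\phi_h^{m+1},\phi_h^m),\psi\big)-\varepsilon^{-1}\big(\tfrac32\phi_h^m-\tfrac12\phi_h^{m-1},\psi\big)+\varepsilon\,a\big(\tfrac34\phi_h^{m+1}+\tfrac14\phi_h^{m-1},\psi\big)-(\mu_h^{m+1/2},\psi)=0.$$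
   Context: $\Omega\subset\mathbb{R}^d$, $d\in\{2,3\}$, is an open polygonal or polyhedral domain; $(\cdot,\cdot)$ is the $L^2(\Omega)$ inner product and $a(u,v):=(\nabla u,\nabla v)$. $T>0$, $M$ is a positive integer, $\tau=T/M$. $\mathcal{T}_h$ is a conforming, shape-regular, quasi-uniform triangulation of $\Omega$, $q\ge1$ is an integer, and $S_h:=\{v\in C^0(\Omega): v|_K\in\mathcal{P}_q(K)\ \forall K\in\mathcal{T}_h\}\subset H^1(\Omega)$. The nonlinearity is $$\chi(u,v):=\tfrac12(u^2+v^2)\cdot\tfrac12(u+v).$$ In the scheme the initial data are $\phi_h^0=R_h\phi_0$ and $\mu_h^0=R_h\mu_0$, with $\phi_0\in H^2(\Omega)$, $\partial_n\phi_0=0$ on $\partial\Omega$, $\mu_0:=\varepsilon^{-1}(\phi_0^3-\phi_0)-\varepsilon\Delta\phi_0$ (assumed to lie in $H^1(\Omega)$), where the Ritz projection $R_h:H^1(\Omega)\to S_h$ is defined by $a(R_h\phi-\phi,\xi)=0$ for all $\xi\in S_h$ and $(R_h\phi-\phi,1)=0$. *)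

theory Defs
  imports "HOL-Analysis.Analysis"
begin

section \<open>Domains and meshes\<close>

text \<open>Open bounded polygonal (polyhedral) domains: the boundary consists of finitely many
  flat pieces of codimension one. Convexity and Lipschitz regularity are not required.\<close>

definition polyhedral_domain :: "(real^'n) set \<Rightarrow> bool" where
  "polyhedral_domain \<Omega> \<longleftrightarrow>
     open \<Omega> \<and> connected \<Omega> \<and> bounded \<Omega> \<and> \<Omega> \<noteq> {} \<and>
     (\<exists>F. finite F \<and> (\<forall>P\<in>F. polytope P \<and> aff_dim P = int CARD('n) - 1) \<and>
          frontier \<Omega> = \<Union>F)"

text \<open>Elements are closed simplices of full dimension. Conformity is the condition in
  \<^const>\<open>triangulation\<close> that two elements meet in a common (possibly empty) face.\<close>

definition conforming_mesh :: "(real^'n) set \<Rightarrow> (real^'n) set set \<Rightarrow> bool" where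
  "conforming_mesh \<Omega> \<T> \<longleftrightarrow>
     triangulation \<T> \<and> (\<forall>K\<in>\<T>. int CARD('n) simplex K) \<and>
     \<Union>\<T> = closure \<Omega> \<and> (\<forall>K\<in>\<T>. interior K \<subseteq> \<Omega>)"

text \<open>Shape-regularity and quasi-uniformity only have content for a family of meshes, with
  constants independent of the mesh parameter. The set \<open>H\<close> collects the mesh
  parameters of the family, and \<open>h\<close> is the largest element diameter of \<open>\<T> h\<close>.\<close>

definition shape_regular :: "real set \<Rightarrow> (real \<Rightarrow> (real^'n) set set) \<Rightarrow> bool" where
  "shape_regular H \<T> \<longleftrightarrow>
     (\<exists>\<rho>>0. \<forall>h\<in>H. \<forall>K\<in>\<T> h. \<exists>x. ball x (\<rho> * diameter K) \<subseteq> K)"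

definition quasi_uniform :: "real set \<Rightarrow> (real \<Rightarrow> (real^'n) set set) \<Rightarrow> bool" where
  "quasi_uniform H \<T> \<longleftrightarrow> (\<exists>c>0. \<forall>h\<in>H. \<forall>K\<in>\<T> h. c * h \<le> diameter K)"

definition mesh_family ::
    "(real^'n) set \<Rightarrow> real set \<Rightarrow> (real \<Rightarrow> (real^'n) set set) \<Rightarrow> bool" where
  "mesh_family \<Omega> H \<T> \<longleftrightarrow>
     (\<forall>h\<in>H. h > 0 \<and> conforming_mesh \<Omega> (\<T> h) \<and> h = Max (diameter ` \<T> h)) \<and>
     shape_regular H \<T> \<and> quasi_uniform H \<T>"


section \<open>The finite element space\<close>

text \<open>Real polynomials in the coordinates of total degree at most \<open>q\<close>; the
  multi-indices are functions \<open>\<alpha> :: 'n \<Rightarrow> nat\<close>.\<close>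

definition polys :: "nat \<Rightarrow> (real^'n \<Rightarrow> real) set" where
  "polys q = {p. \<exists>c :: ('n \<Rightarrow> nat) \<Rightarrow> real.
     p = (\<lambda>x. \<Sum>\<alpha> | (\<Sum>i\<in>UNIV. \<alpha> i) \<le> q. c \<alpha> * (\<Prod>i\<in>UNIV. (x $ i) ^ \<alpha> i))}"

text \<open>A function on \<open>\<Omega>\<close> is represented by its extension by zero to the whole
  space, so that equality of representatives is equality on \<open>\<Omega>\<close>. Being functions on
  the open set \<open>\<Omega>\<close>, the members of the space are compared with a polynomial on
  \<open>K \<inter> \<Omega>\<close>.\<close>

definition fe_space :: "(real^'n) set \<Rightarrow> (real^'n) set set \<Rightarrow> nat \<Rightarrow> (real^'n \<Rightarrow> real) set" where
  "fe_space \<Omega> \<T> q =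
     {v. continuous_on \<Omega> v \<and> (\<forall>x. x \<notin> \<Omega> \<longrightarrow> v x = 0) \<and>
         (\<forall>K\<in>\<T>. \<exists>p\<in>polys q. \<forall>x\<in>K \<inter> \<Omega>. v x = p x)}"


section \<open>Weak gradients and the bilinear forms\<close>

text \<open>\<open>\<psi>\<close> is a continuously differentiable test function with compact support in
  \<open>\<Omega>\<close>, and \<open>D\<close> is its classical gradient.\<close>

definition test_function :: "(real^'n) set \<Rightarrow> (real^'n \<Rightarrow> real) \<Rightarrow> (real^'n \<Rightarrow> real^'n) \<Rightarrow> bool" where
  "test_function \<Omega> \<psi> D \<longleftrightarrow>
     (\<forall>x. GDERIV \<psi> x :> D x) \<and> continuous_on UNIV D \<and>
     compact (closure {x. \<psi> x \<noteq> 0}) \<and> closure {x. \<psi> x \<noteq> 0} \<subseteq> \<Omega>"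

definition has_weak_gradient ::
    "(real^'n) set \<Rightarrow> (real^'n \<Rightarrow> real) \<Rightarrow> (real^'n \<Rightarrow> real^'n) \<Rightarrow> bool" where
  "has_weak_gradient \<Omega> u g \<longleftrightarrow>
     (\<forall>C. compact C \<and> C \<subseteq> \<Omega> \<longrightarrow> set_integrable lebesgue C u \<and> set_integrable lebesgue C g) \<and>
     (\<forall>\<psi> D. test_function \<Omega> \<psi> D \<longrightarrow>
        (LINT x:\<Omega>|lebesgue. u x *\<^sub>R D x) = - (LINT x:\<Omega>|lebesgue. \<psi> x *\<^sub>R g x))"

text \<open>The weak gradient is determined up to a null set only; any representative will do,
  as it is used under integrals.\<close>

definition weak_grad :: "(real^'n) set \<Rightarrow> (real^'n \<Rightarrow> real) \<Rightarrow> real^'n \<Rightarrow> real^'n" where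
  "weak_grad \<Omega> u = (SOME g. has_weak_gradient \<Omega> u g)"

text \<open>Used both for scalar functions, where \<open>\<bullet>\<close> is multiplication, and for vector fields.\<close>

definition L2_inner :: "(real^'n) set \<Rightarrow> (real^'n \<Rightarrow> 'b::real_inner) \<Rightarrow> (real^'n \<Rightarrow> 'b) \<Rightarrow> real" where
  "L2_inner \<Omega> u v = (LINT x:\<Omega>|lebesgue. u x \<bullet> v x)"

definition dirichlet :: "(real^'n) set \<Rightarrow> (real^'n \<Rightarrow> real) \<Rightarrow> (real^'n \<Rightarrow> real) \<Rightarrow> real" where
  "dirichlet \<Omega> u v = L2_inner \<Omega> (weak_grad \<Omega> u) (weak_grad \<Omega> v)"


section \<open>The scheme\<close>

definition chi :: "real \<Rightarrow> real \<Rightarrow> real" where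
  "chi u v = 1/2 * (u\<^sup>2 + v\<^sup>2) * (1/2 * (u + v))"

text \<open>\<open>S\<close> is the discrete space, \<open>\<phi>0\<close> and \<open>\<mu>0\<close> are the initial data, and the
  unknowns are \<open>\<phi>1\<close> and \<open>\<mu>\<close> (at time level one half).\<close>

definition first_step ::
    "(real^'n) set \<Rightarrow> (real^'n \<Rightarrow> real) set \<Rightarrow> real \<Rightarrow> real \<Rightarrow>
     (real^'n \<Rightarrow> real) \<Rightarrow> (real^'n \<Rightarrow> real) \<Rightarrow> (real^'n \<Rightarrow> real) \<Rightarrow> (real^'n \<Rightarrow> real) \<Rightarrow> bool" where
  "first_step \<Omega> S \<epsilon> \<tau> \<phi>0 \<mu>0 \<phi>1 \<mu> \<longleftrightarrow>
     (\<forall>\<nu>\<in>S. \<forall>\<psi>\<in>S.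
        L2_inner \<Omega> (\<lambda>x. (\<phi>1 x - \<phi>0 x) / \<tau>) \<nu> + \<epsilon> * dirichlet \<Omega> \<mu> \<nu> = 0 \<and>
        inverse \<epsilon> * L2_inner \<Omega> (\<lambda>x. chi (\<phi>1 x) (\<phi>0 x)) \<psi>
          - inverse \<epsilon> * L2_inner \<Omega> \<phi>0 \<psi>
          + \<tau> / 2 * dirichlet \<Omega> \<mu>0 \<psi>
          + \<epsilon> * dirichlet \<Omega> (\<lambda>x. 1/2 * \<phi>1 x + 1/2 * \<phi>0 x) \<psi>
          - L2_inner \<Omega> \<mu> \<psi> = 0)"

text \<open>The two previous iterates are \<open>\<phi>c\<close> (current, level \<open>m\<close>) and \<open>\<phi>p\<close> (previous,
  level \<open>m - 1\<close>); the unknowns are \<open>\<phi>n\<close> (level \<open>m + 1\<close>) and \<open>\<mu>\<close> (level \<open>m + 1/2\<close>).\<close>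

definition multi_step ::
    "(real^'n) set \<Rightarrow> (real^'n \<Rightarrow> real) set \<Rightarrow> real \<Rightarrow> real \<Rightarrow>
     (real^'n \<Rightarrow> real) \<Rightarrow> (real^'n \<Rightarrow> real) \<Rightarrow> (real^'n \<Rightarrow> real) \<Rightarrow> (real^'n \<Rightarrow> real) \<Rightarrow> bool" where
  "multi_step \<Omega> S \<epsilon> \<tau> \<phi>c \<phi>p \<phi>n \<mu> \<longleftrightarrow>
     (\<forall>\<nu>\<in>S. \<forall>\<psi>\<in>S.
        L2_inner \<Omega> (\<lambda>x. (\<phi>n x - \<phi>c x) / \<tau>) \<nu> + \<epsilon> * dirichlet \<Omega> \<mu> \<nu> = 0 \<and>
        inverse \<epsilon> * L2_inner \<Omega> (\<lambda>x. chi (\<phi>n x) (\<phi>c x)) \<psi>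
          - inverse \<epsilon> * L2_inner \<Omega> (\<lambda>x. 3/2 * \<phi>c x - 1/2 * \<phi>p x) \<psi>
          + \<epsilon> * dirichlet \<Omega> (\<lambda>x. 3/4 * \<phi>n x + 1/4 * \<phi>p x) \<psi>
          - L2_inner \<Omega> \<mu> \<psi> = 0)"

end

theory Submission
  imports Defs "HOL-Library.Function_Algebras"
begin

text \<open>Write $m$ for the $L^2$ product and $a$ for the Dirichlet form on the discrete space. The
  polynomial $\chi(\cdot, v)$ is the derivative of a convex quartic and is strictly monotone, so each
  step reads $m(x - x_0, \nu) + \kappa a(y, \nu) = 0$, $F'(x)\psi = m(y, \psi)$ with $F$ convex. Testing
  the difference of two solutions with each other gives uniqueness. For existence, take a maximal
  $a$-orthonormal family $f_j$, let $g_j$ represent $-\kappa a(f_j, \cdot)$ in $m$, and minimise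
  $F(x_0 + \sum c_j g_j) + \frac{\kappa}{2} |c|^2$ over the coefficients, which is coercive by
  convexity of $F$ alone. At a minimiser, $y = \sum c_j f_j$ solves the second equation up to a
  residual in the kernel of $a$, and adding this residual to $y$ does not affect the first equation.

  The weak gradient is fixed by a choice operator, so one has to know that it is almost everywhere
  unique and that it exists for finite element functions, where it is the elementwise
  gradient.\<close>

section \<open>Semi-definite forms and saddle point systems\<close>

text \<open>The textbook argument inverts the discrete Laplacian on functions of mean zero and so
  has to identify the kernel of \<open>a\<close>. Here the kernel is never computed: the
  \<open>f j\<close> span a complement of it in \<open>S\<close>, and the first equation forces
  \<open>x - x0\<close> to be a combination of the \<open>g j\<close>. The quadratic penalty is the
  discrete negative norm in disguise, namely \<open>\<kappa> / 2 * a y0 y0\<close> for the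
  \<open>y0\<close> with coefficients \<open>c j\<close>. It supplies the growth: convexity of
  \<open>F\<close> gives only an affine lower bound, which any multiple of
  \<open>(c j)\<^sup>2\<close> eventually beats. Working with coefficients also moves compactness
  and continuity from \<open>S\<close>, which carries no topology here, to
  \<open>nat \<Rightarrow> real\<close>. On the analytic side, \<Omega> need not be convex, so a
  finite element function is Lipschitz only along segments that stay inside \<Omega>. Multiplying by
  a test function repairs this, because its compact support keeps a positive distance from the
  complement of \<Omega>.\<close>

instantiation "fun" :: (type, real_vector) real_vector
begin

text \<open>Together with pointwise addition this makes \<open>subspace\<close>, \<open>span\<close>
  and \<open>independent\<close> available for sets of functions, so that the abstract results apply
  to the finite element space directly.\<close>

definition scaleR_fun_def: "c *\<^sub>R f = (\<lambda>x. c *\<^sub>R f x)"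

instance
  by standard (simp_all add: scaleR_fun_def fun_eq_iff scaleR_add_right scaleR_add_left)

end

lemma scaleR_fun_apply [simp]: "(c *\<^sub>R f) x = c *\<^sub>R f x"
  by (simp add: scaleR_fun_def)

text \<open>Tychonoff's theorem. Coefficient vectors are total sequences rather than tuples, which
  avoids a type depending on the dimension.\<close>

lemma compact_cube_fun: "compact (PiE UNIV (\<lambda>_::nat. {-R..R::real}))"
proof -
  have "compactin (product_topology (\<lambda>i. euclidean) UNIV) (PiE UNIV (\<lambda>_::nat. {-R..R::real}))"
    by (subst compactin_PiE) auto
  then show ?thesis
    by (simp add: euclidean_product_topology)
qed

text \<open>Linearity is assumed on \<open>S\<close> only, because functionals built from
  \<open>weak_grad\<close> need not be linear on functions without a weak gradient.\<close>

lemma linear_on_subspace_sum: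
  fixes l :: "'a::real_vector \<Rightarrow> real" and n :: nat
  assumes S: "subspace S"
    and add: "\<And>x y. x \<in> S \<Longrightarrow> y \<in> S \<Longrightarrow> l (x + y) = l x + l y"
    and scale: "\<And>c x. x \<in> S \<Longrightarrow> l (c *\<^sub>R x) = c * l x"
    and "\<And>j. j < n \<Longrightarrow> g j \<in> S"
  shows "l (\<Sum>j<n. c j *\<^sub>R g j) = (\<Sum>j<n. c j * l (g j))"
  using assms(4)
proof (induction n)
  case 0
  show ?case using scale[of 0 0] subspace_0[OF S] by simp
next
  case (Suc n)
  have "(\<Sum>j<n. c j *\<^sub>R g j) \<in> S"
    using Suc.prems by (intro subspace_sum[OF S] subspace_scale[OF S]) auto
  then show ?case using Suc by (simp add: add scale subspace_scale[OF S])
qed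

section \<open>Semi-definite forms and their orthonormal families\<close>

text \<open>Definiteness is left out so that one locale serves both the L2 product and the Dirichlet
  form, which vanishes on constants.\<close>

locale psd_form =
  fixes S :: "'a::real_vector set" and b :: "'a \<Rightarrow> 'a \<Rightarrow> real"
  assumes subspace: "subspace S"
    and add_left: "\<lbrakk>x \<in> S; y \<in> S; z \<in> S\<rbrakk> \<Longrightarrow> b (x + y) z = b x z + b y z"
    and scale_left: "\<lbrakk>x \<in> S; z \<in> S\<rbrakk> \<Longrightarrow> b (c *\<^sub>R x) z = c * b x z"
    and sym: "\<lbrakk>x \<in> S; z \<in> S\<rbrakk> \<Longrightarrow> b x z = b z x"
    and nonneg: "x \<in> S \<Longrightarrow> 0 \<le> b x x"
begin

lemma mem_add: "x \<in> S \<Longrightarrow> y \<in> S \<Longrightarrow> x + y \<in> S"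
  and mem_diff: "x \<in> S \<Longrightarrow> y \<in> S \<Longrightarrow> x - y \<in> S"
  and mem_scale: "x \<in> S \<Longrightarrow> c *\<^sub>R x \<in> S"
  and mem_zero: "0 \<in> S"
  using subspace by (auto intro: subspace_add subspace_diff subspace_scale subspace_0)

lemma mem_sum: "(\<And>i. i \<in> I \<Longrightarrow> f i \<in> S) \<Longrightarrow> (\<Sum>i\<in>I. c i *\<^sub>R f i) \<in> S"
  by (rule subspace_sum[OF subspace]) (rule mem_scale)

lemma zero_left: "z \<in> S \<Longrightarrow> b 0 z = 0"
  using scale_left[of 0 z 0] mem_zero by simp

lemma diff_left: "\<lbrakk>x \<in> S; y \<in> S; z \<in> S\<rbrakk> \<Longrightarrow> b (x - y) z = b x z - b y z"
  using add_left[of x "(-1) *\<^sub>R y" z] scale_left[of y z "-1"] mem_scale[of y "-1"] by simp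

lemma sum_left:
  "\<lbrakk>\<And>i. i \<in> I \<Longrightarrow> f i \<in> S; z \<in> S\<rbrakk> \<Longrightarrow> b (\<Sum>i\<in>I. c i *\<^sub>R f i) z = (\<Sum>i\<in>I. c i * b (f i) z)"
proof (induction I rule: infinite_finite_induct)
  case (insert i I)
  then show ?case
    by (simp add: add_left scale_left mem_scale mem_sum)
qed (auto simp: zero_left)

lemma add_right: "\<lbrakk>x \<in> S; y \<in> S; z \<in> S\<rbrakk> \<Longrightarrow> b z (x + y) = b z x + b z y"
  using add_left[of x y z] sym mem_add by metis

lemma diff_right: "\<lbrakk>x \<in> S; y \<in> S; z \<in> S\<rbrakk> \<Longrightarrow> b z (x - y) = b z x - b z y"
  using diff_left[of x y z] sym mem_diff by metis

lemma scale_right: "\<lbrakk>x \<in> S; z \<in> S\<rbrakk> \<Longrightarrow> b z (c *\<^sub>R x) = c * b z x"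
  using scale_left[of x z] sym mem_scale by metis

lemma sum_right:
  assumes "\<And>i. i \<in> I \<Longrightarrow> f i \<in> S" "z \<in> S"
  shows "b z (\<Sum>i\<in>I. c i *\<^sub>R f i) = (\<Sum>i\<in>I. c i * b z (f i))"
  using assms sym[of z] mem_sum[of I f c] by (simp add: sum_left)

text \<open>For a null vector \<open>y\<close> the map from \<open>t\<close> to
  \<open>b (x + t *\<^sub>R y) (x + t *\<^sub>R y)\<close> is affine, and an affine function bounded
  below has slope zero.\<close>

lemma null_left:
  assumes "x \<in> S" "y \<in> S" "b y y = 0"
  shows "b y x = 0"
proof (rule ccontr)
  assume nz: "b y x \<noteq> 0"
  \<comment> \<open>The value at which the affine function would equal -1.\<close>
  define t where "t = - (b x x + 1) / (2 * b y x)"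
  have "0 \<le> b (x + t *\<^sub>R y) (x + t *\<^sub>R y)"
    using assms by (intro nonneg mem_add mem_scale)
  also have "\<dots> = b x x + 2 * t * b y x"
    using assms sym[of x y]
    by (simp add: add_left add_right scale_left scale_right mem_add mem_scale)
  also have "\<dots> = -1"
    using nz by (simp add: t_def field_simps)
  finally show False by simp
qed

definition orthonormal_family :: "nat \<Rightarrow> (nat \<Rightarrow> 'a) \<Rightarrow> bool" where
  "orthonormal_family n f \<longleftrightarrow>
     (\<forall>j<n. f j \<in> S) \<and> (\<forall>i<n. \<forall>j<n. b (f i) (f j) = (if i = j then 1 else 0))"

lemma coeff_orthonormal_family:
  assumes "orthonormal_family n f" "j < n"
  shows "b (\<Sum>i<n. c i *\<^sub>R f i) (f j) = c j"
proof -
  have "b (\<Sum>i<n. c i *\<^sub>R f i) (f j) = (\<Sum>i<n. c i * b (f i) (f j))"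
    using assms by (intro sum_left) (auto simp: orthonormal_family_def)
  also have "\<dots> = (\<Sum>i<n. if i = j then c i else 0)"
    using assms by (intro sum.cong) (auto simp: orthonormal_family_def)
  finally show ?thesis using assms by simp
qed

text \<open>Pairing a vanishing combination with \<open>f j\<close> isolates its j-th coefficient,
  so the family is independent. The bound makes a family of greatest length exist.\<close>

lemma card_orthonormal_family:
  assumes "orthonormal_family n f" "finite B" "S \<subseteq> span B"
  shows "n \<le> card B"
proof -
  have inj: "inj_on f {..<n}"
    using assms(1) unfolding inj_on_def orthonormal_family_def
    by (metis lessThan_iff zero_neq_one)
  have "independent (f ` {..<n})"
  proof (rule independent_if_scalars_zero)
    fix u x assume u: "(\<Sum>v\<in>f ` {..<n}. u v *\<^sub>R v) = 0" and x: "x \<in> f ` {..<n}"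
    then obtain j where j: "j < n" "x = f j" by auto
    have "(\<Sum>i<n. u (f i) *\<^sub>R f i) = 0"
      using u by (simp add: sum.reindex[OF inj] o_def)
    then show "u x = 0"
      using coeff_orthonormal_family[OF assms(1) j(1), of "\<lambda>i. u (f i)"] assms(1) j
        zero_left[of "f j"] by (auto simp: orthonormal_family_def)
  qed simp
  moreover have "f ` {..<n} \<subseteq> span B"
    using assms by (auto simp: orthonormal_family_def)
  ultimately have "card (f ` {..<n}) \<le> card B"
    using independent_span_bound assms(2) by blast
  then show ?thesis by (simp add: card_image[OF inj])
qed

text \<open>Gram-Schmidt by maximality: a projection remainder of positive length could be
  normalised and appended to a longest family. For a semi-definite form the remainder is merely
  null, not zero.\<close>

lemma exists_complete_orthonormal_family:
  assumes "finite B" "S \<subseteq> span B"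
  obtains n f where "orthonormal_family n f"
    and "\<And>x. x \<in> S \<Longrightarrow> b (x - (\<Sum>j<n. b x (f j) *\<^sub>R f j)) (x - (\<Sum>j<n. b x (f j) *\<^sub>R f j)) = 0"
proof -
  define P where "P n \<longleftrightarrow> (\<exists>f. orthonormal_family n f)" for n
  have bound: "P n \<Longrightarrow> n \<le> card B" for n
    using card_orthonormal_family assms by (auto simp: P_def)
  have "P 0" by (auto simp: P_def orthonormal_family_def)
  define n where "n = Greatest P"
  have "P n" and max: "\<And>k. P k \<Longrightarrow> k \<le> n"
    using GreatestI_nat[of P 0 "card B"] Greatest_le_nat[of P _ "card B"] \<open>P 0\<close> bound
    by (auto simp: n_def)
  then obtain f where f: "orthonormal_family n f" by (auto simp: P_def)
  have fS: "j < n \<Longrightarrow> f j \<in> S" for j using f by (auto simp: orthonormal_family_def)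
  show thesis
  proof (rule that[OF f])
    fix x assume x: "x \<in> S"
    define y where "y = x - (\<Sum>j<n. b x (f j) *\<^sub>R f j)"
    have pS: "(\<Sum>j<n. b x (f j) *\<^sub>R f j) \<in> S" using fS by (auto intro: mem_sum)
    then have yS: "y \<in> S" using x by (auto simp: y_def intro: mem_diff)
    have yf: "b y (f j) = 0" if "j < n" for j
      using coeff_orthonormal_family[OF f that, of "\<lambda>j. b x (f j)"] diff_left[OF x pS fS[OF that]]
      by (simp add: y_def)
    have "b y y = 0"
    proof (rule ccontr)
      assume "b y y \<noteq> 0"
      then have pos: "b y y > 0" using nonneg[OF yS] by simp
      define e where "e = (1 / sqrt (b y y)) *\<^sub>R y"
      have eS: "e \<in> S" using yS by (simp add: e_def mem_scale)
      have ee: "b e e = 1"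
        using pos yS by (simp add: e_def scale_left scale_right mem_scale)
      have ef: "b e (f j) = 0" "b (f j) e = 0" if "j < n" for j
        using yf[OF that] yS fS[OF that] sym[of "f j" e] eS by (auto simp: e_def scale_left)
      have "orthonormal_family (Suc n) (f(n := e))"
        using f eS ee ef by (auto simp: orthonormal_family_def less_Suc_eq)
      then have "P (Suc n)" by (auto simp: P_def)
      then show False using max by force
    qed
    then show "b (x - (\<Sum>j<n. b x (f j) *\<^sub>R f j)) (x - (\<Sum>j<n. b x (f j) *\<^sub>R f j)) = 0"
      by (simp add: y_def)
  qed
qed

text \<open>Definiteness upgrades null remainders to zero, so every element equals its expansion and
  the coefficients of the representer are the values \<open>l (f j)\<close>.\<close>

lemma riesz_representation:
  assumes "finite B" "S \<subseteq> span B"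
    and definite: "\<And>x. x \<in> S \<Longrightarrow> b x x = 0 \<Longrightarrow> x = 0"
    and add: "\<And>x y. x \<in> S \<Longrightarrow> y \<in> S \<Longrightarrow> l (x + y) = l x + l y"
    and scale: "\<And>c x. x \<in> S \<Longrightarrow> l (c *\<^sub>R x) = c * l x"
  obtains r where "r \<in> S" "\<And>x. x \<in> S \<Longrightarrow> b r x = l x"
proof -
  obtain n f where f: "orthonormal_family n f"
    and null: "\<And>x. x \<in> S \<Longrightarrow> b (x - (\<Sum>j<n. b x (f j) *\<^sub>R f j)) (x - (\<Sum>j<n. b x (f j) *\<^sub>R f j)) = 0"
    using exists_complete_orthonormal_family[OF assms(1,2)] by blast
  have fS: "j < n \<Longrightarrow> f j \<in> S" for j using f by (auto simp: orthonormal_family_def)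
  define r where "r = (\<Sum>j<n. l (f j) *\<^sub>R f j)"
  show thesis
  proof
    show "r \<in> S" using fS by (auto simp: r_def intro: mem_sum)
    fix x assume x: "x \<in> S"
    have "x - (\<Sum>j<n. b x (f j) *\<^sub>R f j) \<in> S"
      using x fS by (intro mem_diff mem_sum) auto
    then have "x - (\<Sum>j<n. b x (f j) *\<^sub>R f j) = 0"
      using definite null x by blast
    then have "l x = l (\<Sum>j<n. b x (f j) *\<^sub>R f j)" by simp
    also have "\<dots> = (\<Sum>j<n. b x (f j) * l (f j))" by (rule linear_on_subspace_sum[OF subspace add scale fS])
    also have "\<dots> = (\<Sum>j<n. l (f j) * b (f j) x)"
      using x fS by (intro sum.cong) (auto simp: sym)
    also have "\<dots> = b r x" unfolding r_def using x fS by (intro sum_left[symmetric]) auto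
    finally show "b r x = l x" by simp
  qed
qed

end

section \<open>Minimisation over finitely many coefficients\<close>

text \<open>Outside a large cube the quadratic minorant already exceeds its value at 0, so the
  minimum over the compact cube is global. Since \<open>G\<close> sees only the first
  \<open>n\<close> coordinates, the remaining ones may be reset to 0 to enter the cube.\<close>

lemma coercive_attains_min:
  fixes G :: "(nat \<Rightarrow> real) \<Rightarrow> real"
  assumes cont: "continuous_on UNIV G"
    and cong: "\<And>c d. (\<And>j. j < n \<Longrightarrow> c j = d j) \<Longrightarrow> G c = G d"
    and lower: "\<And>c. G c \<ge> G (\<lambda>_. 0) + (\<Sum>j<n. l j * c j + \<kappa> * (c j)\<^sup>2)"
    and "\<kappa> > 0"
  shows "\<exists>c. \<forall>d. G c \<le> G d"
proof -
  \<comment> \<open>After completing squares the minorant exceeds \<open>G (\<lambda>_. 0)\<close>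
    as soon as the sum of the \<open>(d j)\<^sup>2\<close> reaches \<open>L\<close>.\<close>
  define L where "L = (\<Sum>j<n. (l j)\<^sup>2) / \<kappa>\<^sup>2"
  \<comment> \<open>Chosen so that both \<open>R \<ge> 1\<close> and \<open>R \<ge> L\<close>,
    whence \<open>L \<le> R * R\<close> without square roots.\<close>
  define R where "R = 2 * L + 1"
  have L0: "L \<ge> 0" by (auto simp: L_def intro!: divide_nonneg_nonneg sum_nonneg)
  let ?C = "PiE UNIV (\<lambda>_::nat. {-R..R})"
  have "(\<lambda>_. 0) \<in> ?C" using L0 by (auto simp: R_def)
  then have "?C \<noteq> {}" by blast
  from continuous_attains_inf[OF compact_cube_fun this continuous_on_subset[OF cont subset_UNIV]]
  obtain c where c: "c \<in> ?C" and cmin: "\<And>d. d \<in> ?C \<Longrightarrow> G c \<le> G d" by blast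
  show ?thesis
  proof (intro exI allI)
    fix d
    show "G c \<le> G d"
    proof (cases "\<forall>j<n. d j \<in> {-R..R}")
      case True
      have "G d = G (\<lambda>j. if j < n then d j else 0)" by (rule cong) simp
      moreover have "(\<lambda>j. if j < n then d j else 0) \<in> ?C" using True L0 by (auto simp: R_def)
      ultimately show ?thesis using cmin by simp
    next
      case False
      then obtain i where i: "i < n" "\<bar>d i\<bar> > R" by force
      have sq: "l j * d j + \<kappa> * (d j)\<^sup>2 \<ge> \<kappa> / 2 * (d j)\<^sup>2 - (l j)\<^sup>2 / (2 * \<kappa>)" for j
      proof -
        have "0 \<le> (\<kappa> * d j + l j)\<^sup>2 / (2 * \<kappa>)" using \<open>\<kappa> > 0\<close> by simp
        also have "\<dots> = l j * d j + \<kappa> * (d j)\<^sup>2 - (\<kappa> / 2 * (d j)\<^sup>2 - (l j)\<^sup>2 / (2 * \<kappa>))"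
          using \<open>\<kappa> > 0\<close> by (simp add: field_simps power2_eq_square)
        finally show ?thesis by simp
      qed
      have "R \<ge> 1" "R \<ge> L" using L0 by (auto simp: R_def)
      then have "L \<le> R * R" using L0 mult_mono[of 1 R L R] by simp
      also have "\<dots> \<le> (d i)\<^sup>2"
        using i(2) \<open>R \<ge> 1\<close> abs_le_square_iff[of R "d i"] by (simp add: power2_eq_square)
      also have "\<dots> \<le> (\<Sum>j<n. (d j)\<^sup>2)"
        using i(1) by (intro member_le_sum) auto
      finally have "0 \<le> \<kappa> / 2 * ((\<Sum>j<n. (d j)\<^sup>2) - L)" using \<open>\<kappa> > 0\<close> by simp
      also have "\<dots> = (\<Sum>j<n. \<kappa> / 2 * (d j)\<^sup>2 - (l j)\<^sup>2 / (2 * \<kappa>))"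
        using \<open>\<kappa> > 0\<close>
        by (simp add: L_def sum_subtractf sum_distrib_left[symmetric] sum_divide_distrib[symmetric]
            field_simps power2_eq_square)
      also have "\<dots> \<le> (\<Sum>j<n. l j * d j + \<kappa> * (d j)\<^sup>2)"
        using sq by (intro sum_mono) auto
      finally have "G (\<lambda>_. 0) \<le> G d" using lower[of d] by simp
      then show ?thesis using cmin[OF \<open>(\<lambda>_. 0) \<in> ?C\<close>] by simp
    qed
  qed
qed

text \<open>Differentiability is needed only in single directions at a point, and continuity only
  along finite families of directions.\<close>

theorem saddle_point_system_solvable:
  fixes S :: "'a::real_vector set" and F :: "'a \<Rightarrow> real" and F' :: "'a \<Rightarrow> 'a \<Rightarrow> real"
  assumes "psd_form S m" and definite: "\<And>x. x \<in> S \<Longrightarrow> m x x = 0 \<Longrightarrow> x = 0"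
    and "psd_form S a"
    and fin: "finite B" "S \<subseteq> span B"
    and "\<kappa> > 0" and x0: "x0 \<in> S"
    and F'_add: "\<And>x y z. \<lbrakk>x \<in> S; y \<in> S; z \<in> S\<rbrakk> \<Longrightarrow> F' x (y + z) = F' x y + F' x z"
    and F'_scale: "\<And>x y c. \<lbrakk>x \<in> S; y \<in> S\<rbrakk> \<Longrightarrow> F' x (c *\<^sub>R y) = c * F' x y"
    and convex: "\<And>x y. \<lbrakk>x \<in> S; y \<in> S\<rbrakk> \<Longrightarrow> F x + F' x (y - x) \<le> F y"
    and deriv: "\<And>x y. \<lbrakk>x \<in> S; y \<in> S\<rbrakk> \<Longrightarrow>
                  ((\<lambda>t. F (x + t *\<^sub>R y)) has_real_derivative F' x y) (at 0)"
    and cont: "\<And>(n::nat) g. (\<And>j. j < n \<Longrightarrow> g j \<in> S) \<Longrightarrow>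
                 continuous_on UNIV (\<lambda>c::nat \<Rightarrow> real. F (x0 + (\<Sum>j<n. c j *\<^sub>R g j)))"
  shows "\<exists>x\<in>S. \<exists>y\<in>S. (\<forall>z\<in>S. m (x - x0) z + \<kappa> * a y z = 0) \<and> (\<forall>z\<in>S. F' x z = m y z)"
proof -
  interpret m: psd_form S m by fact
  interpret a: psd_form S a by fact
  obtain n f where f: "a.orthonormal_family n f"
    and null: "\<And>x. x \<in> S \<Longrightarrow> a (x - (\<Sum>j<n. a x (f j) *\<^sub>R f j)) (x - (\<Sum>j<n. a x (f j) *\<^sub>R f j)) = 0"
    using a.exists_complete_orthonormal_family[OF fin] by blast
  have fS: "j < n \<Longrightarrow> f j \<in> S" for j using f by (auto simp: a.orthonormal_family_def)
  \<comment> \<open>\<open>g j\<close> is \<kappa> times the discrete Laplacian of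
    \<open>f j\<close>: choosing \<open>f j\<close> for \<open>y\<close> in the first equation
    displaces \<open>x\<close> from \<open>x0\<close> by exactly \<open>g j\<close>.\<close>
  have "\<exists>g. \<forall>j<n. g j \<in> S \<and> (\<forall>z\<in>S. m (g j) z = - \<kappa> * a (f j) z)"
  proof -
    have "\<exists>g. g \<in> S \<and> (\<forall>z\<in>S. m g z = - \<kappa> * a (f j) z)" if j: "j < n" for j
    proof -
      obtain r where "r \<in> S" "\<And>x. x \<in> S \<Longrightarrow> m r x = - \<kappa> * a (f j) x"
        using m.riesz_representation[OF fin definite, of "\<lambda>z. - \<kappa> * a (f j) z"] fS[OF j]
        by (auto simp: a.add_right a.scale_right algebra_simps)
      then show ?thesis by blast
    qed
    then show ?thesis by metis
  qed
  then obtain g where gS: "\<And>j. j < n \<Longrightarrow> g j \<in> S"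
    and g: "\<And>j z. j < n \<Longrightarrow> z \<in> S \<Longrightarrow> m (g j) z = - \<kappa> * a (f j) z"
    by blast
  define X where "X c = x0 + (\<Sum>j<n. c j *\<^sub>R g j)" for c
  have XS: "X c \<in> S" for c
    using gS x0 by (auto simp: X_def intro!: m.mem_add m.mem_sum)
  have F'_sum: "F' x (\<Sum>j<n. c j *\<^sub>R g j) = (\<Sum>j<n. c j * F' x (g j))" if "x \<in> S" for x c
    using that gS by (intro linear_on_subspace_sum[OF m.subspace] F'_add F'_scale) auto
  define G where "G c = F (X c) + (\<Sum>j<n. \<kappa> / 2 * (c j)\<^sup>2)" for c
  have coord: "continuous_on UNIV (\<lambda>c::nat \<Rightarrow> real. c j)" for j
    by (rule continuous_on_product_coordinates)
  have "continuous_on UNIV G"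
    unfolding G_def X_def by (intro continuous_intros cont coord gS)
  moreover have "G c = G d" if "\<And>j. j < n \<Longrightarrow> c j = d j" for c d
    using that by (simp add: G_def X_def)
  \<comment> \<open>The tangent of \<open>F\<close> at \<open>x0\<close> is the linear part of the
    minorant, and the penalty is its quadratic part.\<close>
  moreover have "G (\<lambda>_. 0) + (\<Sum>j<n. F' x0 (g j) * c j + \<kappa> / 2 * (c j)\<^sup>2) \<le> G c" for c
    using convex[OF x0 XS, of c] F'_sum[of x0 c] x0
    by (simp add: G_def X_def sum.distrib mult.commute)
  moreover have "\<kappa> / 2 > 0" using \<open>\<kappa> > 0\<close> by simp
  ultimately have "\<exists>c. \<forall>d. G c \<le> G d"
    by (rule coercive_attains_min)
  then obtain c where c: "\<And>d. G c \<le> G d" by blast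
  define x where "x = X c"
  have xS: "x \<in> S" by (simp add: x_def XS)
  \<comment> \<open>Vanishing of the j-th partial derivative of \<open>G\<close>, obtained by
    perturbing a single coefficient.\<close>
  have stationary: "F' x (g j) + \<kappa> * c j = 0" if j: "j < n" for j
  proof -
    have upd: "(\<Sum>i<n. (c(j := c j + t)) i *\<^sub>R g i) = (\<Sum>i<n. c i *\<^sub>R g i) + t *\<^sub>R g j" for t
    proof -
      have "(\<Sum>i<n. (c(j := c j + t)) i *\<^sub>R g i)
          = (\<Sum>i<n. c i *\<^sub>R g i + (if i = j then t *\<^sub>R g i else 0))"
        by (intro sum.cong) (auto simp: scaleR_left_distrib)
      then show ?thesis using j by (simp add: sum.distrib)
    qed
    have upd2: "(\<Sum>i<n. \<kappa> / 2 * ((c(j := c j + t)) i)\<^sup>2)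
        = (\<Sum>i<n. \<kappa> / 2 * (c i)\<^sup>2) + \<kappa> / 2 * (2 * t * c j + t\<^sup>2)" for t
    proof -
      have "(\<Sum>i<n. \<kappa> / 2 * ((c(j := c j + t)) i)\<^sup>2)
          = (\<Sum>i<n. \<kappa> / 2 * (c i)\<^sup>2 + (if i = j then \<kappa> / 2 * (2 * t * c j + t\<^sup>2) else 0))"
        by (intro sum.cong) (auto simp: power2_sum algebra_simps)
      then show ?thesis using j by (simp add: sum.distrib)
    qed
    have Gt: "G (c(j := c j + t)) = F (x + t *\<^sub>R g j) + ((\<Sum>i<n. \<kappa> / 2 * (c i)\<^sup>2) + \<kappa> / 2 * (2 * t * c j + t\<^sup>2))" for t
      unfolding G_def upd2 by (simp only: X_def upd x_def add.assoc)
    have "((\<lambda>t. G (c(j := c j + t))) has_real_derivative (F' x (g j) + \<kappa> * c j)) (at 0)"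
      unfolding Gt by (rule derivative_eq_intros deriv[OF xS gS[OF j]] refl | simp)+
    moreover have "\<forall>t. \<bar>0 - t\<bar> < 1 \<longrightarrow> G (c(j := c j + 0)) \<le> G (c(j := c j + t))"
      using c by simp
    ultimately show ?thesis
      by (rule DERIV_local_min[OF _ zero_less_one])
  qed
  define y0 where "y0 = (\<Sum>j<n. c j *\<^sub>R f j)"
  have y0S: "y0 \<in> S" using fS by (auto simp: y0_def intro: a.mem_sum)
  \<comment> \<open>\<open>r\<close> is the defect of the second equation for \<open>y0\<close>.
    Stationarity says that it is \<open>m\<close>-orthogonal to every \<open>g j\<close>, that is,
    \<open>a\<close>-orthogonal to every \<open>f j\<close>.\<close>
  obtain r where rS: "r \<in> S" and r: "\<And>z. z \<in> S \<Longrightarrow> m r z = F' x z - m y0 z"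
    using m.riesz_representation[OF fin definite, of "\<lambda>z. F' x z - m y0 z"] xS y0S
    by (auto simp: F'_add F'_scale m.add_right m.scale_right algebra_simps)
  have ay0: "a y0 (f j) = c j" if "j < n" for j
    unfolding y0_def by (rule a.coeff_orthonormal_family[OF f that])
  have arf: "a r (f j) = 0" if j: "j < n" for j
  proof -
    have "- \<kappa> * a r (f j) = m (g j) r"
      using g[OF j rS] a.sym[OF rS fS[OF j]] by simp
    also have "\<dots> = F' x (g j) - m y0 (g j)"
      using r[OF gS[OF j]] m.sym[OF rS gS[OF j]] by simp
    also have "m y0 (g j) = - \<kappa> * c j"
      using g[OF j y0S] m.sym[OF y0S gS[OF j]] a.sym[OF y0S fS[OF j]] ay0[OF j] by simp
    finally show ?thesis using stationary[OF j] \<open>\<kappa> > 0\<close> by simp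
  qed
  \<comment> \<open>Orthogonality to the \<open>f j\<close> suffices, because \<open>z\<close>
    differs from its projection by a null vector and null vectors are orthogonal to
    everything.\<close>
  have ar: "a r z = 0" if z: "z \<in> S" for z
  proof -
    let ?p = "\<Sum>j<n. a z (f j) *\<^sub>R f j"
    have pS: "?p \<in> S" using fS by (intro a.mem_sum) auto
    have "a (z - ?p) r = 0" by (rule a.null_left[OF rS a.mem_diff[OF z pS] null[OF z]])
    then have "a z r = a ?p r" using z pS rS by (simp add: a.diff_left)
    also have "\<dots> = (\<Sum>j<n. a z (f j) * a (f j) r)" using fS rS by (intro a.sum_left) auto
    also have "\<dots> = 0" using arf fS rS a.sym[of r] by (intro sum.neutral) auto
    finally show ?thesis using a.sym[OF z rS] by simp
  qed
  have "m (x - x0) z + \<kappa> * a (y0 + r) z = 0 \<and> F' x z = m (y0 + r) z" if z: "z \<in> S" for z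
  proof
    have "m (x - x0) z = (\<Sum>j<n. c j * m (g j) z)"
      using gS z m.sum_left[of "{..<n}" g z c] by (simp add: x_def X_def)
    also have "\<dots> = - \<kappa> * (\<Sum>j<n. c j * a (f j) z)"
      using g z by (simp add: sum_distrib_left mult_ac)
    also have "(\<Sum>j<n. c j * a (f j) z) = a y0 z"
      using fS z a.sum_left[of "{..<n}" f z c] by (simp add: y0_def)
    finally show "m (x - x0) z + \<kappa> * a (y0 + r) z = 0"
      using ar z y0S rS by (simp add: a.add_left)
    show "F' x z = m (y0 + r) z"
      using r z y0S rS by (simp add: m.add_left)
  qed
  then show ?thesis
    using xS m.mem_add[OF y0S rS] by blast
qed

text \<open>Pairing the first equations with the difference of the \<open>y\<close> and the second
  with that of the \<open>x\<close> gives \<open>- \<kappa> * a (y1 - y2) (y1 - y2)\<close> for the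
  monotonicity term, hence a wrong sign unless the \<open>x\<close> agree. The second equation then
  determines \<open>y\<close> by definiteness of \<open>m\<close>. The assumption
  \<open>monotone\<close> is strict monotonicity in contrapositive form.\<close>

lemma saddle_point_system_unique:
  assumes "psd_form S m" and definite: "\<And>x. x \<in> S \<Longrightarrow> m x x = 0 \<Longrightarrow> x = 0"
    and "psd_form S a" and "\<kappa> > 0" "x0 \<in> S"
    and F'_diff: "\<And>x y z. \<lbrakk>x \<in> S; y \<in> S; z \<in> S\<rbrakk> \<Longrightarrow> F' x (y - z) = F' x y - F' x z"
    and monotone: "\<And>x y. \<lbrakk>x \<in> S; y \<in> S; F' x (x - y) \<le> F' y (x - y)\<rbrakk> \<Longrightarrow> x = y"
    and S: "x1 \<in> S" "x2 \<in> S" "y1 \<in> S" "y2 \<in> S"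
    and 1: "\<forall>z\<in>S. m (x1 - x0) z + \<kappa> * a y1 z = 0" "\<forall>z\<in>S. F' x1 z = m y1 z"
    and 2: "\<forall>z\<in>S. m (x2 - x0) z + \<kappa> * a y2 z = 0" "\<forall>z\<in>S. F' x2 z = m y2 z"
  shows "x1 = x2 \<and> y1 = y2"
proof -
  interpret m: psd_form S m by fact
  interpret a: psd_form S a by fact
  have xS: "x1 - x2 \<in> S" and yS: "y1 - y2 \<in> S" using S by (auto intro: m.mem_diff)
  have eq: "m (x1 - x2) (y1 - y2) = - \<kappa> * a (y1 - y2) (y1 - y2)"
    using bspec[OF 1(1) yS] bspec[OF 2(1) yS] S yS \<open>x0 \<in> S\<close>
    by (simp add: m.diff_left a.diff_left algebra_simps)
  have "F' x1 (x1 - x2) - F' x2 (x1 - x2) = m (y1 - y2) (x1 - x2)"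
    using 1(2) 2(2) xS S by (simp add: m.diff_left)
  also have "\<dots> = - \<kappa> * a (y1 - y2) (y1 - y2)" using eq m.sym xS yS by simp
  also have "\<dots> \<le> 0" using a.nonneg[OF yS] \<open>\<kappa> > 0\<close> by simp
  finally have x: "x1 = x2" using monotone S by simp
  have "m (y1 - y2) (y1 - y2) = 0"
    using 1(2) 2(2) yS S x by (simp add: m.diff_left)
  then show ?thesis using x definite[OF yS] by simp
qed

section \<open>Uniqueness of weak gradients\<close>

text \<open>The gradient is hidden behind an existential quantifier so that closure rules can be
  chained without computing it.\<close>

definition C1_function :: "(real^'n \<Rightarrow> real) \<Rightarrow> bool" where
  "C1_function f \<longleftrightarrow> (\<exists>D. (\<forall>x. GDERIV f x :> D x) \<and> continuous_on UNIV D)"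

lemma C1_functionI: "(\<And>x. GDERIV f x :> D x) \<Longrightarrow> continuous_on UNIV D \<Longrightarrow> C1_function f"
  unfolding C1_function_def by blast

lemma GDERIV_continuous_on: "(\<And>x. GDERIV f x :> D x) \<Longrightarrow> continuous_on S f"
  by (auto simp: gderiv_def intro!: continuous_at_imp_continuous_on has_derivative_continuous)

lemma C1_function_const: "C1_function (\<lambda>x. c)"
  by (rule C1_functionI[of _ "\<lambda>x. 0"]) (auto intro: GDERIV_const)

lemma C1_function_component: "C1_function (\<lambda>x. x $ i)"
  by (rule C1_functionI[of _ "\<lambda>x. axis i 1"])
    (auto simp: gderiv_def inner_axis intro!: bounded_linear_imp_has_derivative bounded_linear_vec_nth)

lemma C1_function_add:
  assumes "C1_function f" "C1_function g"
  shows "C1_function (\<lambda>x. f x + g x)"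
proof -
  obtain Df Dg where D: "\<And>x. GDERIV f x :> Df x" "continuous_on UNIV Df"
    "\<And>x. GDERIV g x :> Dg x" "continuous_on UNIV Dg"
    using assms by (auto simp: C1_function_def)
  show ?thesis
    by (rule C1_functionI[of _ "\<lambda>x. Df x + Dg x"]) (intro GDERIV_add continuous_on_add D)+
qed

lemma C1_function_mult:
  assumes "C1_function f" "C1_function g"
  shows "C1_function (\<lambda>x. f x * g x)"
proof -
  obtain Df Dg where D: "\<And>x. GDERIV f x :> Df x" "continuous_on UNIV Df"
    "\<And>x. GDERIV g x :> Dg x" "continuous_on UNIV Dg"
    using assms by (auto simp: C1_function_def)
  show ?thesis
  proof (rule C1_functionI)
    show "GDERIV (\<lambda>x. f x * g x) x :> f x *\<^sub>R Dg x + g x *\<^sub>R Df x" for x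
      by (intro GDERIV_mult D)
    show "continuous_on UNIV (\<lambda>x. f x *\<^sub>R Dg x + g x *\<^sub>R Df x)"
      by (intro continuous_intros D GDERIV_continuous_on[OF D(1)] GDERIV_continuous_on[OF D(3)])
  qed
qed

lemma C1_function_power: "C1_function f \<Longrightarrow> C1_function (\<lambda>x. f x ^ n)"
  by (induction n) (auto intro: C1_function_const C1_function_mult)

lemma C1_function_sum: "(\<And>i. i \<in> I \<Longrightarrow> C1_function (f i)) \<Longrightarrow> C1_function (\<lambda>x. \<Sum>i\<in>I. f i x)"
  by (induction I rule: infinite_finite_induct) (auto intro: C1_function_const C1_function_add)

lemma C1_function_prod: "(\<And>i. i \<in> I \<Longrightarrow> C1_function (f i)) \<Longrightarrow> C1_function (\<lambda>x. \<Prod>i\<in>I. f i x)"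
  by (induction I rule: infinite_finite_induct) (auto intro: C1_function_const C1_function_mult)

lemma C1_function_inverse:
  assumes "C1_function f" "\<And>x. f x \<noteq> 0"
  shows "C1_function (\<lambda>x. inverse (f x))"
proof -
  obtain D where D: "\<And>x. GDERIV f x :> D x" "continuous_on UNIV D"
    using assms by (auto simp: C1_function_def)
  show ?thesis
  proof (rule C1_functionI)
    show "GDERIV (\<lambda>x. inverse (f x)) x :> - (inverse (f x))\<^sup>2 *\<^sub>R D x" for x
      by (intro GDERIV_inverse D assms)
    show "continuous_on UNIV (\<lambda>x. - (inverse (f x))\<^sup>2 *\<^sub>R D x)"
      by (intro continuous_intros D GDERIV_continuous_on[OF D(1)] ballI assms)
  qed
qed

text \<open>Squaring removes the kink of the positive part: at 0 the difference quotient is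
  \<open>max 0 h\<close>, which tends to 0. This is the source of compactly supported functions of
  class C1.\<close>

lemma DERIV_pos_part_square: "((\<lambda>s::real. (max 0 s)\<^sup>2) has_real_derivative 2 * max 0 s) (at s)"
proof -
  consider "s > 0" | "s < 0" | "s = 0" by linarith
  then show ?thesis
  proof cases
    case 1
    have "((\<lambda>s::real. s\<^sup>2) has_real_derivative 2 * max 0 s) (at s)"
      using 1 by (auto intro!: derivative_eq_intros)
    then show ?thesis
      by (rule has_field_derivative_transform_within_open[of _ _ _ "{0<..}"]) (use 1 in auto)
  next
    case 2
    have "((\<lambda>s::real. 0) has_real_derivative 2 * max 0 s) (at s)"
      using 2 by (auto intro!: derivative_eq_intros)
    then show ?thesis
      by (rule has_field_derivative_transform_within_open[of _ _ _ "{..<0}"]) (use 2 in auto)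
  next
    case 3
    have "((\<lambda>h::real. max 0 h) \<longlongrightarrow> max 0 0) (at 0)"
      by (intro tendsto_intros)
    moreover have "eventually (\<lambda>h::real. max 0 h = ((max 0 (0 + h))\<^sup>2 - (max 0 0)\<^sup>2) / h) (at 0)"
      by (auto simp: eventually_at_filter max_def power2_eq_square)
    ultimately have "((\<lambda>h::real. ((max 0 (0 + h))\<^sup>2 - (max 0 0)\<^sup>2) / h) \<longlongrightarrow> max 0 0) (at 0)"
      using tendsto_cong by fast
    then show ?thesis using 3 by (simp add: DERIV_def)
  qed
qed

lemma C1_function_pos_part_square:
  assumes "C1_function f"
  shows "C1_function (\<lambda>x. (max 0 (f x))\<^sup>2)"
proof -
  obtain D where D: "\<And>x. GDERIV f x :> D x" "continuous_on UNIV D"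
    using assms by (auto simp: C1_function_def)
  show ?thesis
  proof (rule C1_functionI)
    show "GDERIV (\<lambda>x. (max 0 (f x))\<^sup>2) x :> (2 * max 0 (f x)) *\<^sub>R D x" for x
      by (rule GDERIV_DERIV_compose[OF D(1) DERIV_pos_part_square])
    show "continuous_on UNIV (\<lambda>x. (2 * max 0 (f x)) *\<^sub>R D x)"
      by (intro continuous_intros D GDERIV_continuous_on[OF D(1)])
  qed
qed

text \<open>With \<open>f\<close> positive exactly on the open box, the functions \<open>1 - 1 / (1 + n f)\<close> increase to
  its indicator.\<close>

lemma box_indicator_C1_approximation:
  fixes c d :: "real^'n"
  assumes "\<And>i. c $ i < d $ i"
  obtains \<psi> where "\<And>n::nat. C1_function (\<psi> n)"
    and "\<And>n x. x \<notin> box c d \<Longrightarrow> \<psi> n x = 0"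
    and "\<And>n x. \<bar>\<psi> n x\<bar> \<le> 1"
    and "\<And>x. (\<lambda>n. \<psi> n x) \<longlonglongrightarrow> indicator (box c d) x"
proof -
  \<comment> \<open>Differences are written with \<open>+ -\<close> and \<open>-1 *\<close> to fit
    the closure rules for constants, coordinates, sums and products.\<close>
  define f :: "real^'n \<Rightarrow> real"
    where "f x = (\<Prod>i\<in>UNIV. (max 0 ((x $ i + - c $ i) * (d $ i + -1 * x $ i)))\<^sup>2)" for x
  define \<psi> where "\<psi> n x = 1 + -1 * inverse (1 + real n * f x)" for n :: nat and x
  have f0: "f x \<ge> 0" for x by (auto simp: f_def intro: prod_nonneg)
  have pos: "1 + real n * f x > 0" for n x
    using f0[of x] by (intro add_pos_nonneg) auto
  have inside: "f x > 0" if "x \<in> box c d" for x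
  proof -
    have "0 < (x $ i + - c $ i) * (d $ i + -1 * x $ i)" for i
      using that by (intro mult_pos_pos) (auto simp: mem_box_cart)
    then show ?thesis
      unfolding f_def by (intro prod_pos ballI zero_less_power) (simp add: less_max_iff_disj)
  qed
  have outside: "f x = 0" if out: "x \<notin> box c d" for x
  proof -
    obtain i where i: "\<not> (c $ i < x $ i \<and> x $ i < d $ i)"
      using out by (auto simp: mem_box_cart)
    then have "(x $ i + - c $ i) * (d $ i + -1 * x $ i) \<le> 0"
      using assms[of i] by (auto simp: mult_le_0_iff)
    then have "(max 0 ((x $ i + - c $ i) * (d $ i + -1 * x $ i)))\<^sup>2 = 0" by simp
    then show ?thesis unfolding f_def by (intro prod_zero) auto
  qed
  have "C1_function f"
    unfolding f_def
    by (intro C1_function_prod C1_function_pos_part_square C1_function_mult C1_function_add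
        C1_function_component C1_function_const)
  show thesis
  proof
    show "C1_function (\<psi> n)" for n
      unfolding \<psi>_def using pos[of n] \<open>C1_function f\<close>
      by (intro C1_function_inverse C1_function_mult C1_function_add C1_function_const)
        (auto simp: less_le)
    show "\<psi> n x = 0" if "x \<notin> box c d" for n x using outside[OF that] by (simp add: \<psi>_def)
    show "\<bar>\<psi> n x\<bar> \<le> 1" for n x
    proof -
      have "inverse (1 + real n * f x) \<le> 1" "inverse (1 + real n * f x) > 0"
        using pos[of n x] f0[of x] by (auto simp: inverse_le_1_iff)
      then show ?thesis by (simp add: \<psi>_def)
    qed
    show "(\<lambda>n. \<psi> n x) \<longlonglongrightarrow> indicator (box c d) x" for x
    proof (cases "x \<in> box c d")
      case True
      have "filterlim (\<lambda>n. 1 + f x * real n) at_top sequentially"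
        using inside[OF True]
        by (intro filterlim_tendsto_add_at_top[OF tendsto_const]
            filterlim_tendsto_pos_mult_at_top[OF tendsto_const] filterlim_real_sequentially)
      then have "(\<lambda>n. inverse (1 + f x * real n)) \<longlonglongrightarrow> 0"
        by (rule tendsto_inverse_0_at_top)
      then have "(\<lambda>n. 1 + -1 * inverse (1 + f x * real n)) \<longlonglongrightarrow> 1 + -1 * 0"
        by (intro tendsto_intros)
      then show ?thesis using True by (simp add: \<psi>_def mult.commute)
    qed (simp add: \<psi>_def outside)
  qed
qed

section \<open>The fundamental lemma of the calculus of variations\<close>

lemma test_function_continuous: "test_function \<Omega> \<psi> D \<Longrightarrow> continuous_on S \<psi>"
  unfolding test_function_def using GDERIV_continuous_on by blast

lemma continuous_on_UNIV_lebesgue_measurable: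
  fixes f :: "'a::euclidean_space \<Rightarrow> 'b::euclidean_space"
  shows "continuous_on UNIV f \<Longrightarrow> f \<in> borel_measurable lebesgue"
  by (intro measurable_completion) (simp add: borel_measurable_continuous_onI)

lemma test_function_bounded:
  assumes "test_function \<Omega> \<psi> D"
  obtains B where "B > 0" "\<And>x. \<bar>\<psi> x\<bar> \<le> B"
proof -
  let ?C = "closure {x. \<psi> x \<noteq> 0}"
  have "compact (\<psi> ` ?C)"
    using assms test_function_continuous[OF assms] by (auto simp: test_function_def intro: compact_continuous_image)
  then obtain B where B: "B > 0" "\<forall>y\<in>\<psi> ` ?C. norm y \<le> B"
    using bounded_normE compact_imp_bounded bounded_pos by meson
  have "\<bar>\<psi> x\<bar> \<le> B" for x
    using B closure_subset[of "{x. \<psi> x \<noteq> 0}"] by (cases "\<psi> x = 0") auto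
  then show thesis using B that by blast
qed

lemma set_integrable_test_function_scaleR:
  fixes g :: "real^'n \<Rightarrow> real^'n"
  assumes \<psi>: "test_function \<Omega> \<psi> D"
    and g: "\<And>C. compact C \<Longrightarrow> C \<subseteq> \<Omega> \<Longrightarrow> set_integrable lebesgue C g"
  shows "set_integrable lebesgue \<Omega> (\<lambda>x. \<psi> x *\<^sub>R g x)"
proof -
  define C where "C = closure {x. \<psi> x \<noteq> 0}"
  have C: "compact C" "C \<subseteq> \<Omega>" using \<psi> by (auto simp: C_def test_function_def)
  have int: "integrable lebesgue (\<lambda>x. indicator C x *\<^sub>R g x)"
    using g[OF C] by (simp add: set_integrable_def)
  obtain B where B: "B > 0" "\<And>x. \<bar>\<psi> x\<bar> \<le> B" using test_function_bounded[OF \<psi>] by blast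
  \<comment> \<open>The factor \<open>\<psi> x\<close> vanishes off its support \<open>C\<close>, so
    local integrability of \<open>g\<close> on that compact set is enough.\<close>
  have eq: "indicator \<Omega> x *\<^sub>R \<psi> x *\<^sub>R g x = \<psi> x *\<^sub>R (indicator C x *\<^sub>R g x)" for x
    using closure_subset[of "{x. \<psi> x \<noteq> 0}"] C by (cases "\<psi> x = 0") (auto simp: C_def indicator_def)
  have "integrable lebesgue (\<lambda>x. \<psi> x *\<^sub>R (indicator C x *\<^sub>R g x))"
  proof (rule Bochner_Integration.integrable_bound)
    show "integrable lebesgue (\<lambda>x. B *\<^sub>R (indicator C x *\<^sub>R g x))"
      using int by (rule integrable_scaleR_right)
    show "(\<lambda>x. \<psi> x *\<^sub>R (indicator C x *\<^sub>R g x)) \<in> borel_measurable lebesgue"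
      by (intro borel_measurable_scaleR continuous_on_UNIV_lebesgue_measurable
          test_function_continuous[OF \<psi>] borel_measurable_integrable[OF int])
    show "AE x in lebesgue. norm (\<psi> x *\<^sub>R (indicator C x *\<^sub>R g x)) \<le> norm (B *\<^sub>R (indicator C x *\<^sub>R g x))"
      using B by (intro AE_I2) (simp only: norm_scaleR[of _ "indicator C _ *\<^sub>R g _"],
          auto intro!: mult_right_mono intro: order_trans[OF B(2)])
  qed
  then show ?thesis unfolding set_integrable_def eq .
qed

text \<open>The approximants of the box indicator are test functions, since their supports lie in
  the closed box, and dominated convergence with majorant \<open>norm (g x)\<close> on that box
  passes to the limit.\<close>

lemma integral_cbox_zero_of_test_functions:
  fixes g :: "real^'n \<Rightarrow> real^'n"
  assumes g: "\<And>C. compact C \<Longrightarrow> C \<subseteq> \<Omega> \<Longrightarrow> set_integrable lebesgue C g"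
    and zero: "\<And>\<psi> D. test_function \<Omega> \<psi> D \<Longrightarrow> (LINT x:\<Omega>|lebesgue. \<psi> x *\<^sub>R g x) = 0"
    and cd: "cbox c d \<subseteq> \<Omega>"
  shows "integral (cbox c d) g = 0"
proof (cases "\<forall>i. c $ i < d $ i")
  case False
  then have "box c d = {}" by (auto simp: interval_eq_empty_cart not_less)
  then have "integral (box c d) g = 0" by simp
  then show ?thesis by (simp add: integral_open_interval)
next
  case True
  then obtain \<psi> where \<psi>: "\<And>n::nat. C1_function (\<psi> n)"
    "\<And>n x. x \<notin> box c d \<Longrightarrow> \<psi> n x = 0" "\<And>n x. \<bar>\<psi> n x\<bar> \<le> 1"
    "\<And>x. (\<lambda>n. \<psi> n x) \<longlonglongrightarrow> indicator (box c d) x"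
    using box_indicator_C1_approximation by blast
  have test: "\<exists>D. test_function \<Omega> (\<psi> n) D" for n
  proof -
    have "closure {x. \<psi> n x \<noteq> 0} \<subseteq> cbox c d"
      using \<psi>(2)[of _ n] box_subset_cbox by (intro closure_minimal closed_cbox) blast
    moreover from this have "compact (closure {x. \<psi> n x \<noteq> 0})"
      using compact_cbox bounded_cbox bounded_subset compact_eq_bounded_closed closed_closure by blast
    ultimately show ?thesis
      using \<psi>(1)[of n] cd unfolding test_function_def C1_function_def by blast
  qed
  have int: "integrable lebesgue (\<lambda>x. indicator (cbox c d) x *\<^sub>R g x)"
    using g[OF compact_cbox cd] by (simp add: set_integrable_def)
  have intb: "set_integrable lebesgue (box c d) g"
    using g[OF compact_cbox cd] by (rule set_integrable_subset) (auto simp: box_subset_cbox)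
  have eq: "indicator \<Omega> x *\<^sub>R \<psi> n x *\<^sub>R g x = \<psi> n x *\<^sub>R (indicator (cbox c d) x *\<^sub>R g x)" for x n
    using \<psi>(2)[of x n] cd box_subset_cbox[of c d] by (cases "x \<in> box c d") (auto simp: indicator_def)
  have "(\<lambda>n. \<integral>x. \<psi> n x *\<^sub>R (indicator (cbox c d) x *\<^sub>R g x) \<partial>lebesgue)
        \<longlonglongrightarrow> (\<integral>x. indicator (box c d) x *\<^sub>R g x \<partial>lebesgue)"
  proof (rule integral_dominated_convergence)
    show "(\<lambda>x. indicator (box c d) x *\<^sub>R g x) \<in> borel_measurable lebesgue"
      using intb by (auto simp: set_integrable_def)
    show "(\<lambda>x. \<psi> n x *\<^sub>R (indicator (cbox c d) x *\<^sub>R g x)) \<in> borel_measurable lebesgue" for n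
      using test[of n]
      by (intro borel_measurable_scaleR continuous_on_UNIV_lebesgue_measurable
          borel_measurable_integrable[OF int]) (auto intro: test_function_continuous)
    show "integrable lebesgue (\<lambda>x. norm (indicator (cbox c d) x *\<^sub>R g x))"
      using int by (rule integrable_norm)
    show "AE x in lebesgue. norm (\<psi> n x *\<^sub>R (indicator (cbox c d) x *\<^sub>R g x))
            \<le> norm (indicator (cbox c d) x *\<^sub>R g x)" for n
      using \<psi>(3)[of n] by (intro AE_I2) (simp only: norm_scaleR[of _ "indicator (cbox c d) _ *\<^sub>R g _"],
          auto intro!: mult_left_le_one_le)
    show "AE x in lebesgue. (\<lambda>n. \<psi> n x *\<^sub>R (indicator (cbox c d) x *\<^sub>R g x))
            \<longlonglongrightarrow> indicator (box c d) x *\<^sub>R g x"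
    proof (rule AE_I2)
      fix x
      have "(\<lambda>n. \<psi> n x *\<^sub>R (indicator (cbox c d) x *\<^sub>R g x))
              \<longlonglongrightarrow> indicator (box c d) x *\<^sub>R (indicator (cbox c d) x *\<^sub>R g x)"
        by (intro tendsto_intros \<psi>(4))
      also have "indicator (box c d) x *\<^sub>R (indicator (cbox c d) x *\<^sub>R g x) = indicator (box c d) x *\<^sub>R g x"
        using box_subset_cbox[of c d] by (auto simp: indicator_def)
      finally show "(\<lambda>n. \<psi> n x *\<^sub>R (indicator (cbox c d) x *\<^sub>R g x))
            \<longlonglongrightarrow> indicator (box c d) x *\<^sub>R g x" .
    qed
  qed
  moreover have "(\<integral>x. \<psi> n x *\<^sub>R (indicator (cbox c d) x *\<^sub>R g x) \<partial>lebesgue) = 0" for n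
  proof -
    obtain D where "test_function \<Omega> (\<psi> n) D" using test by blast
    from zero[OF this] show ?thesis by (simp only: set_lebesgue_integral_def eq)
  qed
  ultimately have "(\<integral>x. indicator (box c d) x *\<^sub>R g x \<partial>lebesgue) = 0"
    by (simp add: LIMSEQ_const_iff)
  then have "integral (box c d) g = 0"
    using set_lebesgue_integral_eq_integral(2)[OF intb] by (simp add: set_lebesgue_integral_def)
  then show ?thesis by (simp add: integral_open_interval)
qed

text \<open>By Lebesgue differentiation almost every value of \<open>g\<close> is a limit of means
  over small cubes, and all these means are zero. Countably many closed boxes then exhaust
  \<Omega>.\<close>

lemma AE_zero_of_test_functions:
  fixes g :: "real^'n \<Rightarrow> real^'n"
  assumes "open \<Omega>"
    and g: "\<And>C. compact C \<Longrightarrow> C \<subseteq> \<Omega> \<Longrightarrow> set_integrable lebesgue C g"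
    and zero: "\<And>\<psi> D. test_function \<Omega> \<psi> D \<Longrightarrow> (LINT x:\<Omega>|lebesgue. \<psi> x *\<^sub>R g x) = 0"
  shows "AE x in lebesgue. x \<in> \<Omega> \<longrightarrow> g x = 0"
proof -
  have box: "AE x in lebesgue. x \<in> box a b \<longrightarrow> g x = 0" if ab: "cbox a b \<subseteq> \<Omega>" for a b
  proof -
    \<comment> \<open>Cutting off outside one box turns local into global integrability, as the
      differentiation theorem requires.\<close>
    define f where "f x = (if x \<in> cbox a b then g x else 0)" for x
    have "f absolutely_integrable_on UNIV"
      unfolding f_def absolutely_integrable_restrict_UNIV by (rule g[OF compact_cbox ab])
    then have "f integrable_on cbox u v" for u v
      by (rule set_lebesgue_integral_eq_integral(1)[OF set_integrable_subset]) auto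
    from integrable_ccontinuous_explicit[OF this]
    obtain N where N: "negligible N" and lim: "\<And>x e. \<lbrakk>x \<notin> N; 0 < e\<rbrakk> \<Longrightarrow>
        \<exists>\<delta>>0. \<forall>h. 0 < h \<and> h < \<delta> \<longrightarrow>
          norm (integral (cbox x (x + h *\<^sub>R One)) f /\<^sub>R h ^ DIM(real^'n) - f x) < e"
      by blast
    have g0: "g x = 0" if x: "x \<in> box a b" "x \<notin> N" for x
    proof (rule ccontr)
      assume "g x \<noteq> 0"
      have fx: "f x = g x" using x box_subset_cbox by (auto simp: f_def)
      obtain \<delta> where \<delta>: "\<delta> > 0" "\<And>h. 0 < h \<and> h < \<delta> \<Longrightarrow>
          norm (integral (cbox x (x + h *\<^sub>R One)) f /\<^sub>R h ^ DIM(real^'n) - f x) < norm (g x)"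
        using lim[OF x(2), of "norm (g x)"] \<open>g x \<noteq> 0\<close> by auto
      obtain e where e: "e > 0" "ball x e \<subseteq> box a b"
        using x(1) open_box openE by blast
      \<comment> \<open>The first bound makes the mean close to \<open>f x\<close>; the second keeps
        the cube with corner \<open>x\<close> and side \<open>h\<close> inside
        \<open>ball x e\<close>, its diagonal being \<open>h * norm One\<close>.\<close>
      define h where "h = min (\<delta> / 2) (e / (2 * norm (One :: real^'n) + 1))"
      have h: "0 < h" "h < \<delta>" using \<delta> e by (auto simp: h_def add_nonneg_pos)
      have "h * norm (One :: real^'n) < e"
      proof -
        have "h * norm (One :: real^'n) \<le> e / (2 * norm (One :: real^'n) + 1) * norm (One :: real^'n)"
          by (rule mult_right_mono) (auto simp: h_def)
        also have "\<dots> < e"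
          using e by (simp add: divide_less_eq add_nonneg_pos mult_less_cancel_left_pos
              add_pos_nonneg add.commute)
        finally show ?thesis .
      qed
      have sub: "cbox x (x + h *\<^sub>R One) \<subseteq> box a b"
      proof
        fix y assume y: "y \<in> cbox x (x + h *\<^sub>R One)"
        have "norm (y - x) \<le> norm (h *\<^sub>R (One :: real^'n))"
        proof (rule norm_le_componentwise_cart)
          fix i
          have "x $ i \<le> y $ i" "y $ i \<le> (x + h *\<^sub>R One) $ i"
            using y by (simp_all only: mem_box_cart)
          then show "norm ((y - x) $ i) \<le> norm ((h *\<^sub>R (One :: real^'n)) $ i)"
            unfolding vector_add_component vector_minus_component real_norm_def by arith
        qed
        then have "dist x y < e" using \<open>h * norm One < e\<close> h by (simp add: dist_norm norm_minus_commute)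
        then show "y \<in> box a b" using e by auto
      qed
      have "integral (cbox x (x + h *\<^sub>R One)) f = integral (cbox x (x + h *\<^sub>R One)) g"
        by (rule Henstock_Kurzweil_Integration.integral_cong)
          (use sub box_subset_cbox[of a b] in \<open>auto simp: f_def\<close>)
      also have "\<dots> = 0"
        by (rule integral_cbox_zero_of_test_functions[OF g zero])
          (use sub box_subset_cbox[of a b] ab in auto)
      finally show False using \<delta>(2)[of h] h fx by simp
    qed
    have "AE x in lebesgue. x \<notin> N"
      using N unfolding negligible_iff_null_sets by (rule AE_not_in)
    then show ?thesis by eventually_elim (use g0 in blast)
  qed
  \<comment> \<open>Passing to closed boxes costs only their negligible boundaries and allows an
    exact countable cover of the open set.\<close>
  have cbox: "AE x in lebesgue. x \<in> cbox a b \<longrightarrow> g x = 0" if ab: "cbox a b \<subseteq> \<Omega>" for a b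
  proof -
    have "AE x in lebesgue. x \<notin> cbox a b - box a b"
      using negligible_frontier_interval[of a b] unfolding negligible_iff_null_sets by (rule AE_not_in)
    with box[OF ab] show ?thesis by eventually_elim auto
  qed
  obtain \<D> where \<D>: "countable \<D>" "\<D> \<subseteq> Pow \<Omega>" "\<And>X. X \<in> \<D> \<Longrightarrow> \<exists>a b. X = cbox a b" "\<Union>\<D> = \<Omega>"
    using open_countable_Union_open_cbox[OF \<open>open \<Omega>\<close>] by metis
  have "\<forall>X\<in>\<D>. AE x in lebesgue. x \<in> X \<longrightarrow> g x = 0"
    using \<D>(2,3) cbox by blast
  then have "AE x in lebesgue. \<forall>X\<in>\<D>. x \<in> X \<longrightarrow> g x = 0"
    unfolding AE_ball_countable[OF \<D>(1)] .
  then show ?thesis by eventually_elim (use \<D>(4) in blast)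
qed

lemma has_weak_gradient_unique:
  assumes "open \<Omega>" "has_weak_gradient \<Omega> u g1" "has_weak_gradient \<Omega> u g2"
  shows "AE x in lebesgue. x \<in> \<Omega> \<longrightarrow> g1 x = g2 x"
proof -
  have int1: "set_integrable lebesgue C g1" and int2: "set_integrable lebesgue C g2"
    if "compact C" "C \<subseteq> \<Omega>" for C
    using assms that by (auto simp: has_weak_gradient_def)
  have "AE x in lebesgue. x \<in> \<Omega> \<longrightarrow> g1 x - g2 x = 0"
  proof (rule AE_zero_of_test_functions[OF \<open>open \<Omega>\<close>])
    show "set_integrable lebesgue C (\<lambda>x. g1 x - g2 x)" if "compact C" "C \<subseteq> \<Omega>" for C
      using int1 int2 that by (intro set_integral_diff) auto
    show "(LINT x:\<Omega>|lebesgue. \<psi> x *\<^sub>R (g1 x - g2 x)) = 0" if \<psi>: "test_function \<Omega> \<psi> D" for \<psi> D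
    proof -
      have "(LINT x:\<Omega>|lebesgue. \<psi> x *\<^sub>R (g1 x - g2 x))
          = (LINT x:\<Omega>|lebesgue. \<psi> x *\<^sub>R g1 x) - (LINT x:\<Omega>|lebesgue. \<psi> x *\<^sub>R g2 x)"
        unfolding scaleR_diff_right
        by (intro set_integral_diff set_integrable_test_function_scaleR[OF \<psi>] int1 int2)
      then show ?thesis
        using assms(2,3) \<psi> unfolding has_weak_gradient_def by (metis (no_types, lifting) add.inverse_inverse diff_self)
    qed
  qed
  then show ?thesis by (auto elim: eventually_mono)
qed

section \<open>Weak gradients of piecewise smooth functions\<close>

lemma GDERIV_unique:
  assumes "GDERIV f x :> D" "GDERIV f x :> D'"
  shows "D = D'"
proof -
  have "(\<lambda>h. h \<bullet> D) = (\<lambda>h. h \<bullet> D')"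
    using assms unfolding gderiv_def by (rule has_derivative_unique)
  then show ?thesis by (metis vector_eq_ldot)
qed

lemma GDERIV_transform_within_open:
  assumes "GDERIV f x :> D" "open U" "x \<in> U" "\<And>y. y \<in> U \<Longrightarrow> f y = g y"
  shows "GDERIV g x :> D"
  using assms unfolding gderiv_def by (rule has_derivative_transform_within_open)

lemma GDERIV_directional:
  assumes "GDERIV f x :> D"
  shows "((\<lambda>t. (f (t *\<^sub>R e + x) - f x) / t) \<longlongrightarrow> D \<bullet> e) (at 0)"
proof -
  have "(f has_derivative (\<lambda>h. h \<bullet> D)) (at (0 *\<^sub>R e + x))"
    using assms by (simp add: gderiv_def)
  moreover have "((\<lambda>t. t *\<^sub>R e + x) has_derivative (\<lambda>t. t *\<^sub>R e)) (at 0)"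
    by (auto intro!: derivative_eq_intros)
  ultimately have "((\<lambda>t. f (t *\<^sub>R e + x)) has_derivative (\<lambda>t. (t *\<^sub>R e) \<bullet> D)) (at 0)"
    by (rule has_derivative_compose[rotated])
  then have "((\<lambda>t. f (t *\<^sub>R e + x)) has_real_derivative (D \<bullet> e)) (at 0)"
    by (simp add: has_field_derivative_def inner_commute mult_commute_abs)
  then show ?thesis by (simp add: DERIV_def)
qed

lemma integrable_bounded_support:
  fixes f :: "'a::euclidean_space \<Rightarrow> 'b::{banach, second_countable_topology}"
  assumes "f \<in> borel_measurable borel" "A \<in> sets borel" "bounded A"
    and "\<And>x. norm (f x) \<le> B" "\<And>x. x \<notin> A \<Longrightarrow> f x = 0"
  shows "integrable lborel f"
  by (rule integrableI_bounded_set[where A = A and B = B])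
    (use assms emeasure_bounded_finite[of A] in auto)

text \<open>The slope bound is the mean value inequality on a convex set. The gradient bound is
  phrased for any \<open>D\<close>, as \<open>C1_function\<close> does not name one.\<close>

lemma C1_function_bounded_lipschitz:
  assumes "C1_function p" "compact K" "convex K"
  obtains B where "B \<ge> 0" "\<And>x. x \<in> K \<Longrightarrow> \<bar>p x\<bar> \<le> B"
    "\<And>x D. x \<in> K \<Longrightarrow> GDERIV p x :> D \<Longrightarrow> norm D \<le> B"
    "\<And>x y. x \<in> K \<Longrightarrow> y \<in> K \<Longrightarrow> \<bar>p x - p y\<bar> \<le> B * norm (x - y)"
proof -
  obtain D where D: "\<And>x. GDERIV p x :> D x" "continuous_on UNIV D"
    using assms by (auto simp: C1_function_def)
  have "compact (p ` K)" "compact (D ` K)"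
    using assms(2) GDERIV_continuous_on[OF D(1)] continuous_on_subset[OF D(2)]
    by (auto intro: compact_continuous_image)
  then obtain B1 B2 where B: "B1 > 0" "\<forall>y\<in>p ` K. norm y \<le> B1" "B2 > 0" "\<forall>y\<in>D ` K. norm y \<le> B2"
    using compact_imp_bounded bounded_pos by metis
  show thesis
  proof (rule that[of "max B1 B2"])
    show "max B1 B2 \<ge> 0" using B by auto
    show "\<bar>p x\<bar> \<le> max B1 B2" if "x \<in> K" for x using B that by (auto simp: le_max_iff_disj)
    show "norm D' \<le> max B1 B2" if "x \<in> K" "GDERIV p x :> D'" for x D'
      using B(4) that GDERIV_unique[OF that(2) D(1)] by (auto simp: le_max_iff_disj)
    fix x y assume xy: "x \<in> K" "y \<in> K"
    have "norm (p x - p y) \<le> max B1 B2 * norm (x - y)"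
    proof (rule differentiable_bound[OF assms(3) _ _ xy])
      show "(p has_derivative (\<lambda>h. h \<bullet> D z)) (at z within K)" for z
        using D(1)[of z] unfolding gderiv_def by (rule has_derivative_at_withinI)
      show "onorm (\<lambda>h. h \<bullet> D z) \<le> max B1 B2" if "z \<in> K" for z
      proof (rule onorm_le)
        fix h
        have "\<bar>h \<bullet> D z\<bar> \<le> norm h * norm (D z)" by (rule Cauchy_Schwarz_ineq2)
        also have "\<dots> \<le> norm h * max B1 B2"
          using B(4) that by (intro mult_left_mono) (auto simp: le_max_iff_disj)
        finally show "norm (h \<bullet> D z) \<le> max B1 B2 * norm h" by (simp add: mult.commute)
      qed
    qed
    then show "\<bar>p x - p y\<bar> \<le> max B1 B2 * norm (x - y)" by simp
  qed
qed

definition gradient :: "(real^'n \<Rightarrow> real) \<Rightarrow> real^'n \<Rightarrow> real^'n" where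
  "gradient v x = (SOME D. GDERIV v x :> D)"

lemma gradient_eqI: "GDERIV v x :> D \<Longrightarrow> gradient v x = D"
  unfolding gradient_def using GDERIV_unique by (metis someI)

section \<open>Piecewise smooth functions on a convex mesh\<close>

text \<open>Convexity of the elements serves twice: their frontiers are null sets, and a smooth
  piece is Lipschitz on a whole element.\<close>

locale convex_mesh =
  fixes \<Omega> :: "(real^'n) set" and \<T> :: "(real^'n) set set"
  assumes open_domain: "open \<Omega>" and bounded_domain: "bounded \<Omega>"
    and finite_mesh: "finite \<T>"
    and compact_element: "K \<in> \<T> \<Longrightarrow> compact K"
    and convex_element: "K \<in> \<T> \<Longrightarrow> convex K"
    and interior_element: "K \<in> \<T> \<Longrightarrow> interior K \<subseteq> \<Omega>"
    and Union_mesh: "\<Union>\<T> = closure \<Omega>"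
begin

text \<open>Each piece is smooth on the whole space, hence bounded with its gradient on the compact
  element, although \<open>v\<close> itself matches it only within \<Omega>.\<close>

definition piecewise_C1 :: "(real^'n \<Rightarrow> real) \<Rightarrow> bool" where
  "piecewise_C1 v \<longleftrightarrow> continuous_on \<Omega> v \<and> (\<forall>x. x \<notin> \<Omega> \<longrightarrow> v x = 0) \<and>
     (\<forall>K\<in>\<T>. \<exists>p. C1_function p \<and> (\<forall>x\<in>K \<inter> \<Omega>. v x = p x))"

definition element_interiors :: "(real^'n) set" where
  "element_interiors = (\<Union>K\<in>\<T>. interior K)"

definition broken_gradient :: "(real^'n \<Rightarrow> real) \<Rightarrow> real^'n \<Rightarrow> real^'n" where
  "broken_gradient v x = (if x \<in> element_interiors then gradient v x else 0)"

lemma piecewise_C1_element: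
  assumes "piecewise_C1 v" "K \<in> \<T>"
  obtains p where "C1_function p" "\<And>x. x \<in> K \<inter> \<Omega> \<Longrightarrow> v x = p x"
proof -
  have "\<exists>p. C1_function p \<and> (\<forall>x\<in>K \<inter> \<Omega>. v x = p x)"
    using assms unfolding piecewise_C1_def by (elim conjE) (rule bspec)
  then show thesis using that by (elim exE conjE) metis
qed

lemma domain_borel: "\<Omega> \<in> sets borel"
  using open_domain by simp

text \<open>A point of \<open>closure \<Omega>\<close> in no element interior lies on one of
  finitely many frontiers of convex sets, which are negligible.\<close>

lemma AE_element_interiors: "AE x in lborel. x \<in> element_interiors \<or> x \<notin> closure \<Omega>"
proof -
  have "\<forall>K\<in>\<T>. AE x in lebesgue. x \<notin> frontier K"
  proof
    fix K assume "K \<in> \<T>"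
    then have "negligible (frontier K)" by (intro negligible_convex_frontier convex_element)
    then show "AE x in lebesgue. x \<notin> frontier K"
      unfolding negligible_iff_null_sets by (rule AE_not_in)
  qed
  then have "AE x in lebesgue. \<forall>K\<in>\<T>. x \<notin> frontier K"
    by (subst AE_ball_countable) (auto intro: finite_mesh countable_finite)
  then have "AE x in lborel. \<forall>K\<in>\<T>. x \<notin> frontier K" by (simp add: AE_completion_iff)
  then show ?thesis
  proof eventually_elim
    case (elim x)
    show ?case
    proof (cases "x \<in> closure \<Omega>")
      case True
      then obtain K where K: "K \<in> \<T>" "x \<in> K" using Union_mesh by blast
      then have "x \<in> interior K"
        using elim closure_subset[of K] by (auto simp: frontier_def)
      then show ?thesis using K(1) by (auto simp: element_interiors_def)
    qed simp
  qed
qed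

lemma piecewise_C1_GDERIV:
  assumes "piecewise_C1 v" "K \<in> \<T>" "C1_function p" "\<And>x. x \<in> K \<inter> \<Omega> \<Longrightarrow> v x = p x"
    and "x \<in> interior K"
  shows "GDERIV v x :> gradient p x" "broken_gradient v x = gradient p x" "GDERIV p x :> gradient p x"
proof -
  obtain D where D: "GDERIV p x :> D" using assms(3) by (auto simp: C1_function_def)
  have v: "GDERIV v x :> D"
  proof (rule GDERIV_transform_within_open[OF D open_interior assms(5)])
    fix y assume "y \<in> interior K"
    then have "y \<in> K \<inter> \<Omega>" using interior_element[OF assms(2)] interior_subset[of K] by auto
    then show "p y = v y" using assms(4) by simp
  qed
  show "GDERIV p x :> gradient p x" "GDERIV v x :> gradient p x"
    using D v gradient_eqI[OF D] by auto
  then show "broken_gradient v x = gradient p x"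
    using gradient_eqI[OF v] gradient_eqI[OF D] assms(2,5)
    by (auto simp: broken_gradient_def element_interiors_def)
qed

lemma GDERIV_broken_gradient:
  assumes "piecewise_C1 v" "x \<in> element_interiors"
  shows "GDERIV v x :> broken_gradient v x"
proof -
  obtain K where K: "K \<in> \<T>" "x \<in> interior K" using assms(2) by (auto simp: element_interiors_def)
  obtain p where "C1_function p" "\<And>x. x \<in> K \<inter> \<Omega> \<Longrightarrow> v x = p x"
    using piecewise_C1_element[OF assms(1) K(1)] by metis
  from piecewise_C1_GDERIV[OF assms(1) K(1) this K(2)] show ?thesis by simp
qed

lemma piecewise_C1_add:
  assumes "piecewise_C1 u" "piecewise_C1 v"
  shows "piecewise_C1 (u + v)"
  unfolding piecewise_C1_def
proof (intro conjI ballI)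
  show "continuous_on \<Omega> (u + v)"
    using assms unfolding plus_fun_def piecewise_C1_def by (auto intro: continuous_on_add)
  show "\<forall>x. x \<notin> \<Omega> \<longrightarrow> (u + v) x = 0" using assms by (simp add: piecewise_C1_def)
  fix K assume "K \<in> \<T>"
  then obtain p q where "C1_function p" "\<forall>x\<in>K \<inter> \<Omega>. u x = p x" "C1_function q" "\<forall>x\<in>K \<inter> \<Omega>. v x = q x"
    using assms unfolding piecewise_C1_def by blast
  then show "\<exists>p. C1_function p \<and> (\<forall>x\<in>K \<inter> \<Omega>. (u + v) x = p x)"
    by (intro exI[of _ "\<lambda>x. p x + q x"]) (auto intro: C1_function_add)
qed

lemma piecewise_C1_scale:
  assumes "piecewise_C1 u"
  shows "piecewise_C1 (c *\<^sub>R u)"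
  unfolding piecewise_C1_def
proof (intro conjI ballI)
  show "continuous_on \<Omega> (c *\<^sub>R u)"
    using assms unfolding scaleR_fun_def piecewise_C1_def by (auto intro: continuous_intros)
  show "\<forall>x. x \<notin> \<Omega> \<longrightarrow> (c *\<^sub>R u) x = 0" using assms by (simp add: piecewise_C1_def)
  fix K assume "K \<in> \<T>"
  then obtain p where "C1_function p" "\<forall>x\<in>K \<inter> \<Omega>. u x = p x"
    using assms unfolding piecewise_C1_def by blast
  then show "\<exists>p. C1_function p \<and> (\<forall>x\<in>K \<inter> \<Omega>. (c *\<^sub>R u) x = p x)"
    by (intro exI[of _ "\<lambda>x. c * p x"]) (auto intro: C1_function_mult C1_function_const)
qed

text \<open>Additivity holds at every point, because the value on the skeleton is fixed to 0; the
  chosen \<open>weak_grad\<close> is only determined almost everywhere.\<close>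

lemma broken_gradient_add:
  assumes "piecewise_C1 u" "piecewise_C1 v"
  shows "broken_gradient (u + v) x = broken_gradient u x + broken_gradient v x"
proof (cases "x \<in> element_interiors")
  case True
  have "GDERIV (u + v) x :> broken_gradient u x + broken_gradient v x"
    unfolding plus_fun_def by (intro GDERIV_add GDERIV_broken_gradient assms True)
  then show ?thesis
    using True gradient_eqI by (simp add: broken_gradient_def)
qed (simp add: broken_gradient_def)

lemma broken_gradient_scale:
  assumes "piecewise_C1 u"
  shows "broken_gradient (c *\<^sub>R u) x = c *\<^sub>R broken_gradient u x"
proof (cases "x \<in> element_interiors")
  case True
  have "GDERIV (c *\<^sub>R u) x :> c *\<^sub>R broken_gradient u x + u x *\<^sub>R 0"
    unfolding scaleR_fun_def real_scaleR_def
    by (intro GDERIV_mult GDERIV_const GDERIV_broken_gradient assms True)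
  then show ?thesis
    using True gradient_eqI by (simp add: broken_gradient_def)
qed (simp add: broken_gradient_def)

lemma piecewise_C1_borel:
  assumes "piecewise_C1 v"
  shows "v \<in> borel_measurable borel"
proof -
  have "v = (\<lambda>x. indicator \<Omega> x *\<^sub>R v x)"
    using assms by (auto simp: piecewise_C1_def fun_eq_iff split: split_indicator)
  also have "\<dots> \<in> borel_measurable borel"
    using assms open_domain
    by (intro borel_measurable_continuous_on_indicator) (auto simp: piecewise_C1_def)
  finally show ?thesis .
qed

lemma broken_gradient_borel:
  assumes "piecewise_C1 v"
  shows "broken_gradient v \<in> borel_measurable borel"
proof -
  let ?C = "insert (- element_interiors) (interior ` \<T>)"
  show ?thesis
  proof (rule measurable_piecewise_restrict[of ?C])
    show "countable ?C" using finite_mesh by (simp add: countable_finite)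
    show "space borel \<subseteq> \<Union>?C" by (auto simp: element_interiors_def)
    show "U \<inter> space borel \<in> sets borel" if "U \<in> ?C" for U
    proof -
      have "open element_interiors" by (auto simp: element_interiors_def)
      then show ?thesis using that by auto
    qed
    fix U assume "U \<in> ?C"
    then consider "U = - element_interiors" | K where "K \<in> \<T>" "U = interior K" by auto
    then show "broken_gradient v \<in> borel_measurable (restrict_space borel U)"
    proof cases
      case 1
      then show ?thesis
        by (intro measurable_cong[THEN iffD2, OF _ measurable_const[of 0]])
          (auto simp: space_restrict_space broken_gradient_def)
    next
      case 2
      obtain p where p: "C1_function p" "\<And>x. x \<in> K \<inter> \<Omega> \<Longrightarrow> v x = p x"
        using piecewise_C1_element[OF assms 2(1)] by metis
      then obtain D where D: "\<And>x. GDERIV p x :> D x" "continuous_on UNIV D"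
        by (auto simp: C1_function_def)
      have "D \<in> borel_measurable borel" using D(2) by (rule borel_measurable_continuous_onI)
      then have "D \<in> borel_measurable (restrict_space borel U)" by (rule measurable_restrict_space1)
      moreover have "broken_gradient v x = D x" if "x \<in> U" for x
        using piecewise_C1_GDERIV(2)[OF assms 2(1) p] that 2(2) gradient_eqI[OF D(1)] by simp
      ultimately show ?thesis
        by (subst measurable_cong[of _ _ D]) (auto simp: space_restrict_space)
    qed
  qed
qed

text \<open>Along a segment in \<Omega> the parameters belonging to each element form a closed set
  on which \<open>v\<close> is Lipschitz. Finitely many closed sets cover the unit interval, so the
  bounds glue without following the order in which elements are crossed.\<close>

lemma piecewise_C1_bounds:
  assumes "piecewise_C1 v"
  obtains L where "L \<ge> 0" "\<And>x. \<bar>v x\<bar> \<le> L" "\<And>x. norm (broken_gradient v x) \<le> L"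
    "\<And>x y. closed_segment x y \<subseteq> \<Omega> \<Longrightarrow> \<bar>v x - v y\<bar> \<le> L * norm (x - y)"
proof -
  have "\<forall>K\<in>\<T>. \<exists>p. C1_function p \<and> (\<forall>x\<in>K \<inter> \<Omega>. v x = p x)"
    using assms by (auto simp: piecewise_C1_def)
  then obtain p where p: "\<And>K. K \<in> \<T> \<Longrightarrow> C1_function (p K)"
    "\<And>K x. K \<in> \<T> \<Longrightarrow> x \<in> K \<inter> \<Omega> \<Longrightarrow> v x = p K x"
    by metis
  have "\<forall>K\<in>\<T>. \<exists>B\<ge>0. (\<forall>x\<in>K. \<bar>p K x\<bar> \<le> B) \<and> (\<forall>x\<in>K. \<forall>D. GDERIV (p K) x :> D \<longrightarrow> norm D \<le> B) \<and>
      (\<forall>x\<in>K. \<forall>y\<in>K. \<bar>p K x - p K y\<bar> \<le> B * norm (x - y))"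
  proof
    fix K assume K: "K \<in> \<T>"
    show "\<exists>B\<ge>0. (\<forall>x\<in>K. \<bar>p K x\<bar> \<le> B) \<and> (\<forall>x\<in>K. \<forall>D. GDERIV (p K) x :> D \<longrightarrow> norm D \<le> B) \<and>
      (\<forall>x\<in>K. \<forall>y\<in>K. \<bar>p K x - p K y\<bar> \<le> B * norm (x - y))"
      by (rule C1_function_bounded_lipschitz[OF p(1)[OF K] compact_element[OF K] convex_element[OF K]])
        blast
  qed
  from bchoice[OF this] obtain B where "\<forall>K\<in>\<T>. B K \<ge> 0 \<and> (\<forall>x\<in>K. \<bar>p K x\<bar> \<le> B K) \<and>
      (\<forall>x\<in>K. \<forall>D. GDERIV (p K) x :> D \<longrightarrow> norm D \<le> B K) \<and>
      (\<forall>x\<in>K. \<forall>y\<in>K. \<bar>p K x - p K y\<bar> \<le> B K * norm (x - y))" ..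
  then have B: "\<And>K. K \<in> \<T> \<Longrightarrow> B K \<ge> 0"
    "\<And>K x. K \<in> \<T> \<Longrightarrow> x \<in> K \<Longrightarrow> \<bar>p K x\<bar> \<le> B K"
    "\<And>K x D. K \<in> \<T> \<Longrightarrow> x \<in> K \<Longrightarrow> GDERIV (p K) x :> D \<Longrightarrow> norm D \<le> B K"
    "\<And>K x y. K \<in> \<T> \<Longrightarrow> x \<in> K \<Longrightarrow> y \<in> K \<Longrightarrow> \<bar>p K x - p K y\<bar> \<le> B K * norm (x - y)"
    by simp_all
  \<comment> \<open>A sum of nonnegative bounds dominates each of them and needs no case distinction
    for an empty mesh.\<close>
  define L where "L = sum B \<T>"
  have L0: "L \<ge> 0" using B(1) by (auto simp: L_def intro: sum_nonneg)
  have BL: "B K \<le> L" if "K \<in> \<T>" for K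
    unfolding L_def using that B(1) finite_mesh by (intro member_le_sum) auto
  show thesis
  proof (rule that[OF L0])
    fix x
    show "\<bar>v x\<bar> \<le> L"
    proof (cases "x \<in> \<Omega>")
      case True
      then obtain K where "K \<in> \<T>" "x \<in> K" using Union_mesh closure_subset[of \<Omega>] by auto
      then show ?thesis using p(2)[of K x] B(2)[of K x] BL[of K] True by auto
    qed (use assms L0 in \<open>auto simp: piecewise_C1_def\<close>)
    show "norm (broken_gradient v x) \<le> L"
    proof (cases "x \<in> element_interiors")
      case True
      then obtain K where K: "K \<in> \<T>" "x \<in> interior K" by (auto simp: element_interiors_def)
      note G = piecewise_C1_GDERIV[OF assms K(1) p(1)[OF K(1)] p(2)[OF K(1)] K(2)]
      have "x \<in> K" using K(2) interior_subset by blast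
      then show ?thesis using B(3)[OF K(1) _ G(3)] G(2) BL[OF K(1)] by simp
    qed (use L0 in \<open>simp add: broken_gradient_def\<close>)
  next
    fix x y assume seg: "closed_segment x y \<subseteq> \<Omega>"
    define \<gamma> where "\<gamma> t = x + t *\<^sub>R (y - x)" for t :: real
    have \<gamma>\<Omega>: "\<gamma> t \<in> \<Omega>" if "t \<in> {0..1}" for t
    proof -
      have "\<gamma> t \<in> closed_segment x y"
        using that unfolding closed_segment_def \<gamma>_def by (auto simp: algebra_simps intro!: exI[of _ t])
      then show ?thesis using seg by blast
    qed
    have \<gamma>c: "continuous_on S \<gamma>" for S unfolding \<gamma>_def by (intro continuous_intros)
    have "lipschitz_on (L * norm (y - x)) {0..1} (v \<circ> \<gamma>)"
    proof (rule lipschitz_on_closed_Union[where I = \<T> and U = "\<lambda>K. {t \<in> {0..1}. \<gamma> t \<in> K}"])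
      fix K assume K: "K \<in> \<T>"
      have "closed ({0..1} \<inter> \<gamma> -` K)"
        by (rule continuous_closed_preimage[OF \<gamma>c]) (use K compact_element compact_imp_closed in auto)
      moreover have "{t \<in> {0..1}. \<gamma> t \<in> K} = {0..1} \<inter> \<gamma> -` K" by auto
      ultimately show "closed {t \<in> {0..1}. \<gamma> t \<in> K}" by simp
      show "lipschitz_on (L * norm (y - x)) {t \<in> {0..1}. \<gamma> t \<in> K} (v \<circ> \<gamma>)"
      proof (rule lipschitz_onI)
        fix s t assume st: "s \<in> {t \<in> {0..1}. \<gamma> t \<in> K}" "t \<in> {t \<in> {0..1}. \<gamma> t \<in> K}"
        have "dist ((v \<circ> \<gamma>) s) ((v \<circ> \<gamma>) t) = \<bar>p K (\<gamma> s) - p K (\<gamma> t)\<bar>"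
          using st K p(2)[OF K] \<gamma>\<Omega> by (simp add: dist_real_def)
        also have "\<dots> \<le> B K * norm (\<gamma> s - \<gamma> t)" using B(4)[OF K] st by auto
        also have "\<dots> \<le> L * norm (\<gamma> s - \<gamma> t)" using BL[OF K] by (intro mult_right_mono) auto
        also have "\<gamma> s - \<gamma> t = (s - t) *\<^sub>R (y - x)" by (simp add: \<gamma>_def scaleR_diff_left)
        finally show "dist ((v \<circ> \<gamma>) s) ((v \<circ> \<gamma>) t) \<le> L * norm (y - x) * dist s t"
          by (simp add: dist_real_def mult_ac)
      qed (use L0 in auto)
    next
      show "{0..1} \<subseteq> (\<Union>K\<in>\<T>. {t \<in> {0..1}. \<gamma> t \<in> K})"
        using \<gamma>\<Omega> Union_mesh closure_subset[of \<Omega>] by fastforce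
    qed (use finite_mesh L0 in auto)
    from lipschitz_onD[OF this, of 0 1] show "\<bar>v x - v y\<bar> \<le> L * norm (x - y)"
      by (simp add: \<gamma>_def dist_real_def norm_minus_commute)
  qed
qed

section \<open>The weak gradient is the broken gradient\<close>

text \<open>If neither end point of a short step meets the support of \<psi>, both products vanish.
  Otherwise both end points lie in a ball inside \<Omega>, where \<open>v\<close> is Lipschitz. The
  indicator of a fixed ball makes the bound an integrable majorant.\<close>

lemma piecewise_C1_cutoff_lipschitz:
  assumes v: "piecewise_C1 v" and \<psi>: "test_function \<Omega> \<psi> D" and e: "norm e \<le> 1"
  obtains \<delta> C R where "\<delta> > 0"
    "\<And>t x. 0 < t \<Longrightarrow> t < \<delta> \<Longrightarrow>
       \<bar>v (t *\<^sub>R e + x) * \<psi> (t *\<^sub>R e + x) - v x * \<psi> x\<bar> \<le> t * (C * indicator (cball 0 R) x)"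
proof -
  define C0 where "C0 = closure {x. \<psi> x \<noteq> 0}"
  have C0: "compact C0" "C0 \<subseteq> \<Omega>" and \<psi>C1: "C1_function \<psi>"
    using \<psi> by (auto simp: C0_def test_function_def C1_function_def)
  have \<psi>0: "\<psi> x = 0" if "x \<notin> C0" for x
    using that closure_subset[of "{x. \<psi> x \<noteq> 0}"] by (auto simp: C0_def)
  obtain \<delta>0 where \<delta>0: "\<delta>0 > 0" "(\<Union>x\<in>C0. ball x \<delta>0) \<subseteq> \<Omega>"
    using compact_subset_open_imp_ball_epsilon_subset[OF C0(1) open_domain C0(2)] by blast
  obtain R0 where R0: "\<And>x. x \<in> C0 \<Longrightarrow> norm x \<le> R0"
    using compact_imp_bounded[OF C0(1)] by (auto simp: bounded_iff)
  obtain P where P: "P \<ge> 0" "\<And>x. x \<in> cball 0 (R0 + 2) \<Longrightarrow> \<bar>\<psi> x\<bar> \<le> P"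
    "\<And>x y. x \<in> cball 0 (R0 + 2) \<Longrightarrow> y \<in> cball 0 (R0 + 2) \<Longrightarrow> \<bar>\<psi> x - \<psi> y\<bar> \<le> P * norm (x - y)"
    using C1_function_bounded_lipschitz[OF \<psi>C1 compact_cball convex_cball] by metis
  obtain L where L: "L \<ge> 0" "\<And>x. \<bar>v x\<bar> \<le> L"
    "\<And>x y. closed_segment x y \<subseteq> \<Omega> \<Longrightarrow> \<bar>v x - v y\<bar> \<le> L * norm (x - y)"
    using piecewise_C1_bounds[OF v] by metis
  \<comment> \<open>A step below \<delta>0 stays in a ball inside \<Omega>, and a step below 1 keeps
    both points within radius \<open>R0 + 2\<close>. The factor 2 counts the two terms of the
    product estimate.\<close>
  show thesis
  proof (rule that[of "min \<delta>0 1" "2 * (L * P)" "R0 + 1"])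
    show "min \<delta>0 1 > 0" using \<delta>0 by simp
    fix t :: real and x assume t: "0 < t" "t < min \<delta>0 1"
    define y where "y = t *\<^sub>R e + x"
    have yx: "norm (y - x) \<le> t"
      using t e by (simp add: y_def mult_left_le)
    have "\<bar>v y * \<psi> y - v x * \<psi> x\<bar> \<le> t * (2 * (L * P) * indicator (cball 0 (R0 + 1)) x)"
    proof (cases "x \<in> C0 \<or> y \<in> C0")
      case True
      then obtain z where z: "z \<in> C0" "z = x \<or> z = y" by blast
      have "x \<in> ball z \<delta>0" "y \<in> ball z \<delta>0"
        using z(2) le_less_trans[OF yx, of \<delta>0] t \<delta>0(1)
        by (auto simp: dist_norm norm_minus_commute)
      then have seg: "closed_segment y x \<subseteq> \<Omega>"
        using closed_segment_subset[OF _ _ convex_ball] \<delta>0(2) z(1) by blast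
      have nx: "norm x \<le> R0 + 1" and ny: "norm y \<le> R0 + 2"
        using z(2) R0[OF z(1)] yx t norm_triangle_sub[of x y] norm_triangle_sub[of y x]
        by (auto simp: norm_minus_commute)
      have "\<bar>v y * \<psi> y - v x * \<psi> x\<bar> = \<bar>v y * (\<psi> y - \<psi> x) + (v y - v x) * \<psi> x\<bar>"
        by (simp add: algebra_simps)
      also have "\<dots> \<le> \<bar>v y\<bar> * \<bar>\<psi> y - \<psi> x\<bar> + \<bar>v y - v x\<bar> * \<bar>\<psi> x\<bar>"
        unfolding abs_mult[symmetric] by (rule abs_triangle_ineq)
      also have "\<dots> \<le> L * (P * norm (y - x)) + (L * norm (y - x)) * P"
        using L P nx ny seg by (intro add_mono mult_mono) auto
      also have "\<dots> = 2 * (L * P) * norm (y - x)" by simp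
      also have "\<dots> \<le> 2 * (L * P) * t" using yx L P by (intro mult_left_mono) auto
      finally show ?thesis using nx by (simp add: mult_ac)
    qed (use t L P \<psi>0 in auto)
    then show "\<bar>v (t *\<^sub>R e + x) * \<psi> (t *\<^sub>R e + x) - v x * \<psi> x\<bar>
        \<le> t * (2 * (L * P) * indicator (cball 0 (R0 + 1)) x)"
      by (simp only: y_def)
  qed
qed

lemma broken_gradient_integrand_integrable:
  assumes v: "piecewise_C1 v" and \<psi>: "test_function \<Omega> \<psi> D"
  shows "integrable lborel (\<lambda>x. v x *\<^sub>R D x)" "integrable lborel (\<lambda>x. \<psi> x *\<^sub>R broken_gradient v x)"
proof -
  obtain L where L: "L \<ge> 0" "\<And>x. \<bar>v x\<bar> \<le> L" "\<And>x. norm (broken_gradient v x) \<le> L"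
    using piecewise_C1_bounds[OF v] by metis
  obtain P where P: "P > 0" "\<And>x. \<bar>\<psi> x\<bar> \<le> P" using test_function_bounded[OF \<psi>] by blast
  have D: "continuous_on UNIV D" using \<psi> by (auto simp: test_function_def)
  have "compact (D ` closure \<Omega>)"
    using bounded_domain continuous_on_subset[OF D]
    by (intro compact_continuous_image) (auto simp: compact_closure)
  then obtain Q where Q: "\<And>x. x \<in> closure \<Omega> \<Longrightarrow> norm (D x) \<le> Q"
    using compact_imp_bounded by (force simp: bounded_iff)
  have v0: "v x = 0" if "x \<notin> \<Omega>" for x using v that by (auto simp: piecewise_C1_def)
  have \<psi>0: "\<psi> x = 0" if "x \<notin> \<Omega>" for x
    using \<psi> that closure_subset[of "{x. \<psi> x \<noteq> 0}"] by (auto simp: test_function_def)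
  show "integrable lborel (\<lambda>x. v x *\<^sub>R D x)"
  proof (rule integrable_bounded_support[of _ \<Omega> "L * max Q 0"])
    show "norm (v x *\<^sub>R D x) \<le> L * max Q 0" for x
    proof (cases "x \<in> \<Omega>")
      case True
      then have "norm (D x) \<le> max Q 0" using Q closure_subset by force
      then show ?thesis unfolding norm_scaleR real_norm_def using L by (intro mult_mono) auto
    qed (use v0 L in auto)
    show "(\<lambda>x. v x *\<^sub>R D x) \<in> borel_measurable borel"
      by (rule borel_measurable_scaleR[OF piecewise_C1_borel[OF v] borel_measurable_continuous_onI[OF D]])
  qed (use v0 domain_borel bounded_domain in auto)
  show "integrable lborel (\<lambda>x. \<psi> x *\<^sub>R broken_gradient v x)"
  proof (rule integrable_bounded_support[of _ \<Omega> "P * L"])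
    show "norm (\<psi> x *\<^sub>R broken_gradient v x) \<le> P * L" for x
      unfolding norm_scaleR real_norm_def using L P by (intro mult_mono) (auto intro: less_imp_le)
    show "(\<lambda>x. \<psi> x *\<^sub>R broken_gradient v x) \<in> borel_measurable borel"
      by (rule borel_measurable_scaleR[OF borel_measurable_continuous_onI[OF test_function_continuous[OF \<psi>]]
            broken_gradient_borel[OF v]])
  qed (use \<psi>0 domain_borel bounded_domain in auto)
qed

text \<open>The difference quotients of the cut-off function in a fixed direction have integral zero by
  translation invariance and are dominated because the product is Lipschitz across element
  boundaries. This replaces integration by parts on every element.\<close>

lemma integral_directional_derivative_zero:
  assumes v: "piecewise_C1 v" and \<psi>: "test_function \<Omega> \<psi> D" and e: "norm e \<le> 1"
  shows "(\<integral>x. (v x *\<^sub>R D x + \<psi> x *\<^sub>R broken_gradient v x) \<bullet> e \<partial>lborel) = 0"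
proof -
  define w where "w x = v x * \<psi> x" for x
  define F where "F x = v x *\<^sub>R D x + \<psi> x *\<^sub>R broken_gradient v x" for x
  obtain \<delta> C R where \<delta>: "\<delta> > 0" and CR: "\<And>t x. 0 < t \<Longrightarrow> t < \<delta> \<Longrightarrow>
       \<bar>w (t *\<^sub>R e + x) - w x\<bar> \<le> t * (C * indicator (cball 0 R) x)"
    using piecewise_C1_cutoff_lipschitz[OF v \<psi> e] unfolding w_def by blast
  \<comment> \<open>Adding 2 keeps every step strictly below \<delta>, already for
    \<open>n = 0\<close>.\<close>
  define h where "h n = \<delta> / real (n + 2)" for n :: nat
  have h: "0 < h n" "h n < \<delta>" for n using \<delta> by (auto simp: h_def field_simps intro: add_pos_nonneg)
  have "h \<longlonglongrightarrow> 0"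
    unfolding h_def by (intro tendsto_divide_0[OF tendsto_const] filterlim_at_top_imp_at_infinity
        filterlim_compose[OF filterlim_real_sequentially] filterlim_add_const_nat_at_top)
  then have hlim: "filterlim h (at 0) sequentially"
    using h(1) by (auto simp: filterlim_at intro!: always_eventually) (metis less_irrefl)
  obtain L where L: "L \<ge> 0" "\<And>x. \<bar>v x\<bar> \<le> L" using piecewise_C1_bounds[OF v] by metis
  obtain P where P: "P > 0" "\<And>x. \<bar>\<psi> x\<bar> \<le> P" using test_function_bounded[OF \<psi>] by blast
  have v0: "v x = 0" if "x \<notin> \<Omega>" for x using v that by (auto simp: piecewise_C1_def)
  have wm: "w \<in> borel_measurable borel"
    unfolding w_def using test_function_continuous[OF \<psi>]
    by (intro borel_measurable_times piecewise_C1_borel[OF v] borel_measurable_continuous_onI)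
  have wi: "integrable lborel w"
  proof (rule integrable_bounded_support[of _ \<Omega> "L * P"])
    show "norm (w x) \<le> L * P" for x
      unfolding w_def real_norm_def abs_mult using L P by (intro mult_mono) auto
  qed (use wm domain_borel bounded_domain v0 in \<open>auto simp: w_def\<close>)
  have wti: "integrable lborel (\<lambda>x. w (c + x))" and wt: "(\<integral>x. w (c + x) \<partial>lborel) = (\<integral>x. w x \<partial>lborel)" for c
    using wi wm integrable_distr_eq[of "(+) c" lborel borel w] integral_distr[of "(+) c" lborel borel w]
    by (auto simp: lborel_distr_plus)
  \<comment> \<open>The frontier of \<Omega> needs no case of its own: it lies in
    \<open>closure \<Omega>\<close>, almost every point of which is interior to an element.\<close>
  have deriv: "AE x in lborel. GDERIV w x :> F x"
    using AE_element_interiors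
  proof eventually_elim
    case (elim x)
    then show ?case
    proof
      assume x: "x \<in> element_interiors"
      have "GDERIV \<psi> x :> D x" using \<psi> by (auto simp: test_function_def)
      then show ?thesis
        unfolding w_def F_def by (intro GDERIV_mult GDERIV_broken_gradient[OF v x])
    next
      assume x: "x \<notin> closure \<Omega>"
      have "w y = 0" if "y \<notin> \<Omega>" for y using v0 that by (simp add: w_def)
      then have "GDERIV w x :> 0"
        by (intro GDERIV_transform_within_open[OF GDERIV_const, of "- closure \<Omega>" x 0 w])
          (use x closure_subset in auto)
      moreover have "F x = 0"
      proof -
        have "x \<notin> element_interiors" "x \<notin> \<Omega>"
          using x interior_element closure_subset by (auto simp: element_interiors_def)
        then show ?thesis using v0 by (simp add: F_def broken_gradient_def)
      qed
      ultimately show ?thesis by simp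
    qed
  qed
  have "(\<lambda>n. \<integral>x. (w (h n *\<^sub>R e + x) - w x) / h n \<partial>lborel) \<longlonglongrightarrow> (\<integral>x. F x \<bullet> e \<partial>lborel)"
  proof (rule integral_dominated_convergence)
    show "(\<lambda>x. F x \<bullet> e) \<in> borel_measurable lborel"
      using broken_gradient_integrand_integrable[OF v \<psi>] unfolding F_def
      by (intro borel_measurable_inner borel_measurable_add) auto
    show "(\<lambda>x. (w (h n *\<^sub>R e + x) - w x) / h n) \<in> borel_measurable lborel" for n
      using wti wi by (intro borel_measurable_divide borel_measurable_diff) auto
    show "integrable lborel (\<lambda>x. C * indicator (cball 0 R) x)"
      using emeasure_bounded_finite[OF bounded_cball] by (intro integrable_mult_right integrable_real_indicator) auto
    show "AE x in lborel. (\<lambda>n. (w (h n *\<^sub>R e + x) - w x) / h n) \<longlonglongrightarrow> F x \<bullet> e"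
      using deriv
    proof eventually_elim
      case (elim x)
      show ?case by (rule filterlim_compose[OF GDERIV_directional[OF elim] hlim])
    qed
    show "AE x in lborel. norm ((w (h n *\<^sub>R e + x) - w x) / h n) \<le> C * indicator (cball 0 R) x" for n
    proof (rule AE_I2)
      fix x
      show "norm ((w (h n *\<^sub>R e + x) - w x) / h n) \<le> C * indicator (cball 0 R) x"
        using CR[OF h] h(1)[of n] by (simp add: abs_divide divide_le_eq mult.commute)
    qed
  qed
  moreover have "(\<integral>x. (w (h n *\<^sub>R e + x) - w x) / h n \<partial>lborel) = 0" for n
    using wt wti wi by simp
  ultimately have "(\<lambda>n::nat. 0) \<longlonglongrightarrow> (\<integral>x. F x \<bullet> e \<partial>lborel)" by (simp only:)
  then show ?thesis by (simp add: LIMSEQ_const_iff F_def)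
qed

theorem broken_gradient_weak_gradient:
  assumes v: "piecewise_C1 v"
  shows "has_weak_gradient \<Omega> v (broken_gradient v)"
  unfolding has_weak_gradient_def
proof (intro conjI allI impI)
  obtain L where L: "L \<ge> 0" "\<And>x. \<bar>v x\<bar> \<le> L" "\<And>x. norm (broken_gradient v x) \<le> L"
    using piecewise_C1_bounds[OF v] by metis
  fix C :: "(real^'n) set" assume C: "compact C \<and> C \<subseteq> \<Omega>"
  then have Cb: "C \<in> sets borel" "bounded C" by (auto intro: compact_imp_bounded borel_compact)
  have "integrable lborel (\<lambda>x. indicator C x *\<^sub>R v x)"
    by (rule integrable_bounded_support[of _ C L])
      (use Cb L piecewise_C1_borel[OF v] in \<open>auto simp: indicator_def\<close>)
  then show "set_integrable lebesgue C v"
    unfolding set_integrable_def by (simp add: integrable_completion borel_measurable_integrable)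
  have "integrable lborel (\<lambda>x. indicator C x *\<^sub>R broken_gradient v x)"
    by (rule integrable_bounded_support[of _ C L])
      (use Cb L broken_gradient_borel[OF v] in \<open>auto simp: indicator_def\<close>)
  then show "set_integrable lebesgue C (broken_gradient v)"
    unfolding set_integrable_def by (simp add: integrable_completion borel_measurable_integrable)
next
  fix \<psi> D assume \<psi>: "test_function \<Omega> \<psi> D"
  note int = broken_gradient_integrand_integrable[OF v \<psi>]
  define I where "I = (\<integral>x. v x *\<^sub>R D x + \<psi> x *\<^sub>R broken_gradient v x \<partial>lborel)"
  \<comment> \<open>Since \<open>I \<bullet> sgn I\<close> is the norm of \<open>I\<close>, this
    single direction suffices to make the vector-valued integral vanish.\<close>
  have "I \<bullet> sgn I = (\<integral>x. (v x *\<^sub>R D x + \<psi> x *\<^sub>R broken_gradient v x) \<bullet> sgn I \<partial>lborel)"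
    unfolding I_def using int by (intro integral_inner_left[symmetric]) auto
  also have "\<dots> = 0"
    by (rule integral_directional_derivative_zero[OF v \<psi>]) (simp add: norm_sgn)
  finally have "I = 0" by (simp add: sgn_div_norm dot_square_norm power2_eq_square)
  then have sum: "(\<integral>x. v x *\<^sub>R D x \<partial>lborel) = - (\<integral>x. \<psi> x *\<^sub>R broken_gradient v x \<partial>lborel)"
    unfolding I_def using int by (simp add: eq_neg_iff_add_eq_0)
  have v0: "v x = 0" if "x \<notin> \<Omega>" for x using v that by (auto simp: piecewise_C1_def)
  have \<psi>0: "\<psi> x = 0" if "x \<notin> \<Omega>" for x
    using \<psi> that closure_subset[of "{x. \<psi> x \<noteq> 0}"] by (auto simp: test_function_def)
  have "(LINT x:\<Omega>|lebesgue. v x *\<^sub>R D x) = (\<integral>x. v x *\<^sub>R D x \<partial>lebesgue)"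
    unfolding set_lebesgue_integral_def
    by (intro Bochner_Integration.integral_cong) (auto simp: v0 split: split_indicator)
  moreover have "(LINT x:\<Omega>|lebesgue. \<psi> x *\<^sub>R broken_gradient v x) = (\<integral>x. \<psi> x *\<^sub>R broken_gradient v x \<partial>lebesgue)"
    unfolding set_lebesgue_integral_def
    by (intro Bochner_Integration.integral_cong) (auto simp: \<psi>0 split: split_indicator)
  ultimately show "(LINT x:\<Omega>|lebesgue. v x *\<^sub>R D x) = - (LINT x:\<Omega>|lebesgue. \<psi> x *\<^sub>R broken_gradient v x)"
    using sum int by (simp add: integral_completion borel_measurable_integrable)
qed

lemma weak_grad_AE_eq:
  assumes "piecewise_C1 v"
  shows "AE x in lebesgue. x \<in> \<Omega> \<longrightarrow> weak_grad \<Omega> v x = broken_gradient v x"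
proof (rule has_weak_gradient_unique[OF open_domain])
  show "has_weak_gradient \<Omega> v (broken_gradient v)" by (rule broken_gradient_weak_gradient[OF assms])
  then show "has_weak_gradient \<Omega> v (weak_grad \<Omega> v)" unfolding weak_grad_def by (rule someI[of "has_weak_gradient \<Omega> v"])
qed

end

section \<open>The discrete step\<close>

text \<open>Completeness of Lebesgue measure: altering a preimage by a null set keeps it measurable.
  This lets a chosen weak gradient be exchanged under the integral.\<close>

lemma borel_measurable_lebesgue_AE_cong:
  fixes f g :: "'a::euclidean_space \<Rightarrow> 'b::topological_space"
  assumes g: "g \<in> borel_measurable lebesgue" and ae: "AE x in lebesgue. f x = g x"
  shows "f \<in> borel_measurable lebesgue"
proof (rule measurableI)
  fix A :: "'b set" assume A: "A \<in> sets borel"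
  show "f -` A \<inter> space lebesgue \<in> sets lebesgue"
  proof (rule completion.in_sets_AE)
    show "g -` A \<inter> space lebesgue \<in> sets lebesgue" using g A by (rule measurable_sets)
    show "AE x in lebesgue. (x \<in> g -` A \<inter> space lebesgue) = (x \<in> f -` A \<inter> space lebesgue)"
      using ae by eventually_elim auto
  qed auto
qed auto

lemma lebesgue_integral_AE_cong:
  fixes f g :: "'a::euclidean_space \<Rightarrow> 'b::{banach, second_countable_topology}"
  assumes "g \<in> borel_measurable lebesgue" "AE x in lebesgue. f x = g x"
  shows "integral\<^sup>L lebesgue f = integral\<^sup>L lebesgue g"
  using assms borel_measurable_lebesgue_AE_cong by (intro integral_cong_AE) auto

text \<open>Unlike integrability, this class is closed under products, and on a bounded domain it
  still implies integrability of every polynomial expression.\<close>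

definition bounded_borel :: "('a::euclidean_space \<Rightarrow> 'b::euclidean_space) \<Rightarrow> bool" where
  "bounded_borel f \<longleftrightarrow> f \<in> borel_measurable borel \<and> (\<exists>B. \<forall>x. norm (f x) \<le> B)"

lemma bounded_borel_const: "bounded_borel (\<lambda>x. c)"
  by (auto simp: bounded_borel_def)

lemma bounded_borel_add:
  assumes "bounded_borel f" "bounded_borel g"
  shows "bounded_borel (\<lambda>x. f x + g x)"
proof -
  obtain A B where "\<And>x. norm (f x) \<le> A" "\<And>x. norm (g x) \<le> B"
    using assms by (auto simp: bounded_borel_def)
  then have "norm (f x + g x) \<le> A + B" for x
    by (meson add_mono norm_triangle_le)
  then show ?thesis using assms by (auto simp: bounded_borel_def)
qed

lemma bounded_borel_inner:
  assumes "bounded_borel f" "bounded_borel g"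
  shows "bounded_borel (\<lambda>x. f x \<bullet> g x)"
proof -
  obtain A B where AB: "\<And>x. norm (f x) \<le> A" "\<And>x. norm (g x) \<le> B"
    using assms by (auto simp: bounded_borel_def)
  have "norm (f x \<bullet> g x) \<le> A * B" for x
  proof -
    have "norm (f x \<bullet> g x) \<le> norm (f x) * norm (g x)" by (simp add: Cauchy_Schwarz_ineq2)
    also have "\<dots> \<le> A * B" using AB[of x] by (intro mult_mono) (auto intro: order_trans[OF norm_ge_zero])
    finally show ?thesis .
  qed
  then show ?thesis using assms by (auto simp: bounded_borel_def)
qed

lemma bounded_borel_mult:
  fixes f g :: "'a::euclidean_space \<Rightarrow> real"
  shows "bounded_borel f \<Longrightarrow> bounded_borel g \<Longrightarrow> bounded_borel (\<lambda>x. f x * g x)"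
  using bounded_borel_inner[of f g] by simp

lemma bounded_borel_power:
  fixes f :: "'a::euclidean_space \<Rightarrow> real"
  shows "bounded_borel f \<Longrightarrow> bounded_borel (\<lambda>x. f x ^ k)"
  by (induction k) (auto intro: bounded_borel_const bounded_borel_mult)

lemma bounded_borel_sum:
  "(\<And>i. i \<in> I \<Longrightarrow> bounded_borel (f i)) \<Longrightarrow> bounded_borel (\<lambda>x. \<Sum>i\<in>I. f i x)"
  by (induction I rule: infinite_finite_induct) (auto intro: bounded_borel_const bounded_borel_add)

lemmas bounded_borel_intros =
  bounded_borel_const bounded_borel_add bounded_borel_mult bounded_borel_power bounded_borel_sum

lemma bounded_borel_set_integrable:
  assumes "bounded_borel f" "open \<Omega>" "bounded \<Omega>"
  shows "set_integrable lebesgue \<Omega> f"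
proof -
  obtain B where B: "\<And>x. norm (f x) \<le> B" using assms by (auto simp: bounded_borel_def)
  have "B \<ge> 0" using order_trans[OF norm_ge_zero B] .
  have "integrable lborel (\<lambda>x. indicator \<Omega> x *\<^sub>R f x)"
    by (rule integrable_bounded_support[of _ \<Omega> B])
      (use assms B \<open>B \<ge> 0\<close> in \<open>auto simp: bounded_borel_def split: split_indicator\<close>)
  then show ?thesis
    unfolding set_integrable_def by (simp add: integrable_completion borel_measurable_integrable)
qed

text \<open>A primitive of \<open>\<lambda>u. chi u v\<close>, with every term written as a power of \<open>u\<close> times a factor
  free of \<open>u\<close> so that \<open>continuous_integral_power\<close> applies.\<close>

definition chi_potential :: "real \<Rightarrow> real \<Rightarrow> real" where
  "chi_potential u v =
     1/16 * (u ^ 4 * 1) + 1/12 * (u ^ 3 * v) + 1/8 * (u\<^sup>2 * v\<^sup>2) + 1/4 * (u ^ 1 * v ^ 3)"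

text \<open>The Taylor expansion of a quartic is exact, with \<open>chi u v * s\<close> as linear
  coefficient. After integration the energy is a polynomial in \<open>t\<close>, so no
  differentiation under the integral sign is needed.\<close>

lemma chi_potential_expand:
  "chi_potential (u + t * s) v = chi_potential u v + (t * (chi u v * s)
     + (t\<^sup>2 * (s\<^sup>2 * (3/8 * u\<^sup>2 + 1/4 * (u * v) + 1/8 * v\<^sup>2))
     + (t ^ 3 * (s ^ 3 * (1/4 * u + 1/12 * v)) + t ^ 4 * (1/16 * s ^ 4))))"
  unfolding chi_potential_def chi_def
  by (simp add: field_simps power2_eq_square power3_eq_cube power4_eq_xxxx)

lemma chi_potential_convex:
  "chi_potential u v + chi u v * (w - u) \<le> chi_potential w v"
proof -
  \<comment> \<open>The second-order remainder is \<open>(w - u)\<^sup>2\<close> times a quadratic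
    polynomial in \<open>w - u\<close>; completing the square there gives this sum of
    squares.\<close>
  have "0 \<le> (w - u)\<^sup>2 * (((w - u) / 4 + (3 * u + v) / 6)\<^sup>2 + ((3 * u + v)\<^sup>2 + 6 * v\<^sup>2) / 72)"
    by (intro mult_nonneg_nonneg add_nonneg_nonneg) auto
  also have "\<dots> = chi_potential w v - chi_potential u v - chi u v * (w - u)"
    unfolding chi_potential_def chi_def
    by (simp add: field_simps power2_eq_square power3_eq_cube power4_eq_xxxx)
  finally show ?thesis by simp
qed

lemma chi_strictly_monotone:
  assumes "u \<noteq> w"
  shows "0 < (chi u v - chi w v) * (u - w)"
proof -
  have eq: "(chi u v - chi w v) * (u - w) = (u - w)\<^sup>2 * ((u + v)\<^sup>2 + (w + v)\<^sup>2 + (u + w)\<^sup>2) / 8"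
    unfolding chi_def by (simp add: field_simps power2_eq_square)
  \<comment> \<open>The first two squares vanish together only for
    \<open>u = w = - v\<close>.\<close>
  have "(u + v)\<^sup>2 + (w + v)\<^sup>2 + (u + w)\<^sup>2 > 0"
  proof -
    have "u + v \<noteq> 0 \<or> w + v \<noteq> 0" using assms by auto
    then show ?thesis by (smt (verit) zero_less_power2 zero_le_power2)
  qed
  then show ?thesis using assms unfolding eq by (intro divide_pos_pos mult_pos_pos) auto
qed

section \<open>Forms and energies on piecewise smooth functions\<close>

context convex_mesh
begin

lemma piecewise_C1_bounded_borel:
  assumes "piecewise_C1 v"
  shows "bounded_borel v" "bounded_borel (broken_gradient v)"
  using piecewise_C1_bounds[OF assms] piecewise_C1_borel[OF assms] broken_gradient_borel[OF assms]
  unfolding bounded_borel_def by (metis real_norm_def)+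

lemma set_integrable_domain: "bounded_borel f \<Longrightarrow> set_integrable lebesgue \<Omega> f"
  using bounded_borel_set_integrable open_domain bounded_domain by blast

lemma integral_domain_add:
  assumes "bounded_borel f" "bounded_borel g"
  shows "(LINT x:\<Omega>|lebesgue. f x + g x) = (LINT x:\<Omega>|lebesgue. f x) + (LINT x:\<Omega>|lebesgue. g x)"
  by (intro set_integral_add set_integrable_domain assms)

lemma integral_domain_sum:
  assumes "\<And>i. i \<in> I \<Longrightarrow> bounded_borel (f i)"
  shows "(LINT x:\<Omega>|lebesgue. \<Sum>i\<in>I. f i x) = (\<Sum>i\<in>I. LINT x:\<Omega>|lebesgue. f i x)"
  using assms
  by (induction I rule: infinite_finite_induct)
    (auto simp: integral_domain_add bounded_borel_sum)

lemma integral_domain_mono: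
  fixes f g :: "real^'n \<Rightarrow> real"
  assumes "bounded_borel f" "bounded_borel g" "\<And>x. f x \<le> g x"
  shows "(LINT x:\<Omega>|lebesgue. f x) \<le> (LINT x:\<Omega>|lebesgue. g x)"
  by (intro set_integral_mono set_integrable_domain assms)

lemma integral_domain_zero_imp_AE:
  fixes f :: "real^'n \<Rightarrow> real"
  assumes "bounded_borel f" "\<And>x. 0 \<le> f x" "(LINT x:\<Omega>|lebesgue. f x) \<le> 0"
  shows "AE x in lebesgue. x \<in> \<Omega> \<longrightarrow> f x = 0"
proof -
  have int: "integrable lebesgue (\<lambda>x. indicator \<Omega> x *\<^sub>R f x)"
    using set_integrable_domain[OF assms(1)] by (simp add: set_integrable_def)
  moreover have "integral\<^sup>L lebesgue (\<lambda>x. indicator \<Omega> x *\<^sub>R f x) = 0"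
  proof (rule antisym)
    show "0 \<le> integral\<^sup>L lebesgue (\<lambda>x. indicator \<Omega> x *\<^sub>R f x)"
      using assms(2) by (intro integral_nonneg_AE) auto
  qed (use assms(3) in \<open>simp add: set_lebesgue_integral_def\<close>)
  ultimately have "AE x in lebesgue. indicator \<Omega> x *\<^sub>R f x = 0"
    using integral_nonneg_eq_0_iff_AE[OF int] assms(2) by simp
  then show ?thesis by eventually_elim (simp split: split_indicator_asm)
qed

text \<open>The set where \<open>v\<close> is nonzero in \<Omega> is open and negligible, hence
  empty. This upgrades almost everywhere statements to equality of functions, as uniqueness of the
  discrete solution demands.\<close>

lemma piecewise_C1_eq_zero:
  assumes v: "piecewise_C1 v" and ae: "AE x in lebesgue. x \<in> \<Omega> \<longrightarrow> v x = 0"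
  shows "v = 0"
proof -
  have "open (\<Omega> \<inter> v -` (- {0}))"
    using v open_domain unfolding piecewise_C1_def by (intro continuous_open_preimage) auto
  moreover have "negligible (\<Omega> \<inter> v -` (- {0}))"
  proof -
    have "AE x in lebesgue. x \<notin> \<Omega> \<inter> v -` (- {0})"
      using ae by eventually_elim auto
    then show ?thesis by (simp add: negligible_iff_null_sets completion.null_sets_iff_AE)
  qed
  ultimately have "\<Omega> \<inter> v -` (- {0}) = {}" using open_not_negligible by blast
  then have "v x = 0" for x using v by (cases "x \<in> \<Omega>") (auto simp: piecewise_C1_def)
  then show ?thesis by (simp add: fun_eq_iff)
qed

text \<open>Removes the choice operator from the form once and for all, leaving an integrand that is
  bounded, Borel and exactly bilinear.\<close>

lemma dirichlet_eq_broken: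
  assumes "piecewise_C1 u" "piecewise_C1 v"
  shows "dirichlet \<Omega> u v = L2_inner \<Omega> (broken_gradient u) (broken_gradient v)"
  unfolding dirichlet_def L2_inner_def set_lebesgue_integral_def
proof (rule lebesgue_integral_AE_cong)
  have "bounded_borel (\<lambda>x. broken_gradient u x \<bullet> broken_gradient v x)"
    by (intro bounded_borel_inner piecewise_C1_bounded_borel assms)
  then show "(\<lambda>x. indicator \<Omega> x *\<^sub>R (broken_gradient u x \<bullet> broken_gradient v x)) \<in> borel_measurable lebesgue"
    using set_integrable_domain unfolding set_integrable_def by (intro borel_measurable_integrable)
  show "AE x in lebesgue. indicator \<Omega> x *\<^sub>R (weak_grad \<Omega> u x \<bullet> weak_grad \<Omega> v x)
          = indicator \<Omega> x *\<^sub>R (broken_gradient u x \<bullet> broken_gradient v x)"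
    using weak_grad_AE_eq[OF assms(1)] weak_grad_AE_eq[OF assms(2)]
    by eventually_elim (auto split: split_indicator)
qed

lemma L2_inner_psd_form:
  assumes "subspace S" "S \<subseteq> Collect piecewise_C1"
  shows "psd_form S (L2_inner \<Omega>)"
proof
  show "subspace S" by fact
  fix x y z c assume x: "x \<in> S" and z: "z \<in> S"
  have bb: "bounded_borel v" if "v \<in> S" for v
    using that assms(2) piecewise_C1_bounded_borel by blast
  show "L2_inner \<Omega> (x + y) z = L2_inner \<Omega> x z + L2_inner \<Omega> y z" if "y \<in> S"
    using bb x that z unfolding L2_inner_def
    by (simp add: integral_domain_add bounded_borel_mult inner_add_left distrib_right)
  show "L2_inner \<Omega> (c *\<^sub>R x) z = c * L2_inner \<Omega> x z"
    unfolding L2_inner_def by (simp add: mult.assoc)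
  show "L2_inner \<Omega> x z = L2_inner \<Omega> z x"
    unfolding L2_inner_def by (simp add: mult.commute)
  show "0 \<le> L2_inner \<Omega> x x"
    using integral_domain_mono[of "\<lambda>x. 0" "\<lambda>t. x t * x t"] bb[OF x]
    by (simp add: L2_inner_def bounded_borel_intros)
qed

lemma dirichlet_psd_form:
  assumes "subspace S" "S \<subseteq> Collect piecewise_C1"
  shows "psd_form S (dirichlet \<Omega>)"
proof
  show "subspace S" by fact
  fix x y z c assume x: "x \<in> S" and z: "z \<in> S"
  have pc: "piecewise_C1 v" if "v \<in> S" for v using that assms(2) by blast
  note eq = dirichlet_eq_broken L2_inner_def
  show "dirichlet \<Omega> (x + y) z = dirichlet \<Omega> x z + dirichlet \<Omega> y z" if y: "y \<in> S"
    using pc[OF x] pc[OF y] pc[OF z]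
    by (simp add: eq piecewise_C1_add broken_gradient_add inner_add_left
        integral_domain_add bounded_borel_inner piecewise_C1_bounded_borel)
  show "dirichlet \<Omega> (c *\<^sub>R x) z = c * dirichlet \<Omega> x z"
    using pc[OF x] pc[OF z] by (simp add: eq piecewise_C1_scale broken_gradient_scale)
  show "dirichlet \<Omega> x z = dirichlet \<Omega> z x"
    using pc[OF x] pc[OF z] by (simp add: eq inner_commute)
  show "0 \<le> dirichlet \<Omega> x x"
    using pc[OF x] integral_domain_mono[of "\<lambda>x. 0" "\<lambda>t. broken_gradient x t \<bullet> broken_gradient x t"]
    by (simp add: eq bounded_borel_const bounded_borel_inner piecewise_C1_bounded_borel)
qed

lemma L2_inner_definite:
  assumes "piecewise_C1 v" "L2_inner \<Omega> v v = 0"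
  shows "v = 0"
proof -
  have "AE x in lebesgue. x \<in> \<Omega> \<longrightarrow> v x * v x = 0"
    using assms piecewise_C1_bounded_borel[OF assms(1)]
    by (intro integral_domain_zero_imp_AE) (auto simp: L2_inner_def intro: bounded_borel_intros)
  then have "AE x in lebesgue. x \<in> \<Omega> \<longrightarrow> v x = 0" by eventually_elim simp
  then show ?thesis by (rule piecewise_C1_eq_zero[OF assms(1)])
qed

text \<open>Peeling off one factor of the power moves the coefficients outside the integral and
  multiplies the weight by \<open>w\<close> or \<open>g j\<close>; hence the induction over
  arbitrary weights \<open>z\<close>.\<close>

lemma continuous_integral_power:
  assumes "bounded_borel w" "\<And>j. j < n \<Longrightarrow> bounded_borel (g j)" "bounded_borel z"
  shows "continuous_on UNIV (\<lambda>c::nat \<Rightarrow> real.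
     LINT x:\<Omega>|lebesgue. (w x + (\<Sum>j<n. c j * g j x)) ^ k * z x)"
  using assms(3)
proof (induction k arbitrary: z)
  case (Suc k)
  let ?X = "\<lambda>c x. w x + (\<Sum>j<n. c j * g j x)"
  have X: "bounded_borel (\<lambda>x. ?X c x ^ k)" for c
    using assms(1,2) by (intro bounded_borel_intros) auto
  have eq: "(LINT x:\<Omega>|lebesgue. ?X c x ^ Suc k * z x) = (LINT x:\<Omega>|lebesgue. ?X c x ^ k * (w x * z x))
      + (\<Sum>j<n. c j * (LINT x:\<Omega>|lebesgue. ?X c x ^ k * (g j x * z x)))" for c
  proof -
    have "?X c x ^ Suc k * z x = ?X c x ^ k * (w x * z x) + (\<Sum>j<n. c j * (?X c x ^ k * (g j x * z x)))" for x
      by (simp add: distrib_left distrib_right sum_distrib_left sum_distrib_right mult_ac)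
    then have "(LINT x:\<Omega>|lebesgue. ?X c x ^ Suc k * z x) = (LINT x:\<Omega>|lebesgue. ?X c x ^ k * (w x * z x)
        + (\<Sum>j<n. c j * (?X c x ^ k * (g j x * z x))))" by simp
    also have "\<dots> = (LINT x:\<Omega>|lebesgue. ?X c x ^ k * (w x * z x))
        + (LINT x:\<Omega>|lebesgue. \<Sum>j<n. c j * (?X c x ^ k * (g j x * z x)))"
      using assms(1,2) Suc.prems X by (intro integral_domain_add bounded_borel_intros) auto
    also have "(LINT x:\<Omega>|lebesgue. \<Sum>j<n. c j * (?X c x ^ k * (g j x * z x)))
        = (\<Sum>j<n. LINT x:\<Omega>|lebesgue. c j * (?X c x ^ k * (g j x * z x)))"
      using assms(1,2) Suc.prems X by (intro integral_domain_sum bounded_borel_intros) auto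
    finally show ?thesis by simp
  qed
  show ?case unfolding eq
    using assms(1,2) Suc.prems
    by (intro continuous_intros continuous_on_product_coordinates Suc.IH bounded_borel_mult) auto
qed simp

lemma bounded_borel_chi:
  assumes "bounded_borel u" "bounded_borel v"
  shows "bounded_borel (\<lambda>x. chi (u x) (v x))" "bounded_borel (\<lambda>x. chi_potential (u x) (v x))"
  unfolding chi_def chi_potential_def by (intro bounded_borel_intros assms)+

lemma chi_energy_convex:
  assumes "bounded_borel u" "bounded_borel w" "bounded_borel v"
  shows "(LINT x:\<Omega>|lebesgue. chi_potential (u x) (v x)) + L2_inner \<Omega> (\<lambda>x. chi (u x) (v x)) (w - u)
    \<le> (LINT x:\<Omega>|lebesgue. chi_potential (w x) (v x))"
proof -
  have "bounded_borel (\<lambda>x. w x + -1 * u x)" by (intro bounded_borel_intros assms)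
  then have diff: "bounded_borel (\<lambda>x. chi (u x) (v x) * (w x - u x))"
    using assms by (intro bounded_borel_mult bounded_borel_chi) auto
  have "(LINT x:\<Omega>|lebesgue. chi_potential (u x) (v x)) + L2_inner \<Omega> (\<lambda>x. chi (u x) (v x)) (w - u)
      = (LINT x:\<Omega>|lebesgue. chi_potential (u x) (v x) + chi (u x) (v x) * (w x - u x))"
    using diff assms by (simp add: L2_inner_def integral_domain_add bounded_borel_chi)
  also have "\<dots> \<le> (LINT x:\<Omega>|lebesgue. chi_potential (w x) (v x))"
    using diff assms by (intro integral_domain_mono bounded_borel_add bounded_borel_chi chi_potential_convex)
  finally show ?thesis .
qed

lemma chi_energy_deriv:
  assumes "bounded_borel u" "bounded_borel s" "bounded_borel v"
  shows "((\<lambda>t. LINT x:\<Omega>|lebesgue. chi_potential ((u + t *\<^sub>R s) x) (v x))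
     has_real_derivative L2_inner \<Omega> (\<lambda>x. chi (u x) (v x)) s) (at 0)"
proof -
  let ?I = "\<lambda>f :: real^'n \<Rightarrow> real. LINT x:\<Omega>|lebesgue. f x"
  have "?I (\<lambda>x. chi_potential ((u + t *\<^sub>R s) x) (v x)) = ?I (\<lambda>x. chi_potential (u x) (v x))
      + (t * ?I (\<lambda>x. chi (u x) (v x) * s x)
      + (t\<^sup>2 * ?I (\<lambda>x. (s x)\<^sup>2 * (3/8 * (u x)\<^sup>2 + 1/4 * (u x * v x) + 1/8 * (v x)\<^sup>2))
      + (t ^ 3 * ?I (\<lambda>x. s x ^ 3 * (1/4 * u x + 1/12 * v x)) + t ^ 4 * ?I (\<lambda>x. 1/16 * s x ^ 4))))" for t
    unfolding plus_fun_apply scaleR_fun_apply real_scaleR_def chi_potential_expand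
      set_integral_mult_right[symmetric]
    by (subst integral_domain_add, (intro bounded_borel_intros bounded_borel_chi assms)+)+ simp
  then show ?thesis
    by (auto intro!: derivative_eq_intros simp: L2_inner_def)
qed

lemma chi_energy_continuous:
  assumes "bounded_borel w" "\<And>j. j < n \<Longrightarrow> bounded_borel (g j)" "bounded_borel v"
  shows "continuous_on UNIV (\<lambda>c::nat \<Rightarrow> real.
     LINT x:\<Omega>|lebesgue. chi_potential (w x + (\<Sum>j<n. c j * g j x)) (v x))"
proof -
  let ?I = "\<lambda>f :: real^'n \<Rightarrow> real. LINT x:\<Omega>|lebesgue. f x"
  let ?X = "\<lambda>c x. w x + (\<Sum>j<n. c j * g j x)"
  have X: "bounded_borel (?X c)" for c
    using assms(1,2) by (intro bounded_borel_intros) auto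
  have eq: "?I (\<lambda>x. chi_potential (?X c x) (v x)) = 1/16 * ?I (\<lambda>x. ?X c x ^ 4 * 1)
      + 1/12 * ?I (\<lambda>x. ?X c x ^ 3 * v x) + 1/8 * ?I (\<lambda>x. (?X c x)\<^sup>2 * (v x)\<^sup>2)
      + 1/4 * ?I (\<lambda>x. ?X c x ^ 1 * v x ^ 3)" for c
    unfolding chi_potential_def set_integral_mult_right[symmetric]
    by (subst integral_domain_add, (intro bounded_borel_intros X assms(3))+)+ simp
  show ?thesis
    unfolding eq
    by (intro continuous_intros continuous_integral_power bounded_borel_intros assms)
qed

text \<open>The monotonicity integrand is nonnegative with nonpositive integral, so it vanishes
  almost everywhere; strictness gives \<open>u = w\<close> there and continuity everywhere in
  \<Omega>.\<close>

lemma chi_strictly_monotone_operator: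
  assumes u: "piecewise_C1 u" and w: "piecewise_C1 w" and v: "bounded_borel v"
    and le: "L2_inner \<Omega> (\<lambda>x. chi (u x) (v x)) (u - w) \<le> L2_inner \<Omega> (\<lambda>x. chi (w x) (v x)) (u - w)"
  shows "u = w"
proof -
  note bb = piecewise_C1_bounded_borel(1)
  have pc: "piecewise_C1 (u + (-1) *\<^sub>R w)" by (intro piecewise_C1_add piecewise_C1_scale u w)
  have "u + (-1) *\<^sub>R w = (\<lambda>x. u x - w x)" by (simp add: fun_eq_iff)
  then have d: "bounded_borel (\<lambda>x. u x - w x)" using bb[OF pc] by simp
  have prod: "bounded_borel (\<lambda>x. chi (u x) (v x) * (u x - w x))"
    "bounded_borel (\<lambda>x. chi (w x) (v x) * (u x - w x))"
    by (intro bounded_borel_mult bounded_borel_chi bb u w v d)+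
  have "bounded_borel (\<lambda>x. chi (u x) (v x) * (u x - w x) + -1 * (chi (w x) (v x) * (u x - w x)))"
    by (intro bounded_borel_intros prod)
  then have bbf: "bounded_borel (\<lambda>x. (chi (u x) (v x) - chi (w x) (v x)) * (u x - w x))"
    by (simp add: left_diff_distrib)
  have "(LINT x:\<Omega>|lebesgue. (chi (u x) (v x) - chi (w x) (v x)) * (u x - w x))
      = L2_inner \<Omega> (\<lambda>x. chi (u x) (v x)) (u - w) - L2_inner \<Omega> (\<lambda>x. chi (w x) (v x)) (u - w)"
    unfolding L2_inner_def left_diff_distrib
    using set_integral_diff(2)[OF set_integrable_domain[OF prod(1)] set_integrable_domain[OF prod(2)]]
    by simp
  moreover have "0 \<le> (chi (u x) (v x) - chi (w x) (v x)) * (u x - w x)" for x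
    using chi_strictly_monotone[of "u x" "w x" "v x"] by (cases "u x = w x") auto
  ultimately have "AE x in lebesgue. x \<in> \<Omega> \<longrightarrow> (chi (u x) (v x) - chi (w x) (v x)) * (u x - w x) = 0"
    using le by (intro integral_domain_zero_imp_AE bbf) auto
  then have "AE x in lebesgue. x \<in> \<Omega> \<longrightarrow> (u + (-1) *\<^sub>R w) x = 0"
  proof eventually_elim
    case (elim x)
    then show ?case using chi_strictly_monotone[of "u x" "w x" "v x"] by force
  qed
  then have "u + (-1) *\<^sub>R w = 0" by (rule piecewise_C1_eq_zero[OF pc])
  then show ?thesis by (simp add: fun_eq_iff)
qed

text \<open>Common form of both steps: \<gamma> is the weight of the implicit diffusion, and
  \<open>l\<close> collects all terms in known data.\<close>

theorem semi_implicit_step_uniquely_solvable: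
  fixes l :: "(real^'n \<Rightarrow> real) \<Rightarrow> real"
  assumes S: "subspace S" "S \<subseteq> Collect piecewise_C1" and fin: "finite B" "S \<subseteq> span B"
    and \<phi>c: "\<phi>c \<in> S" and pos: "\<epsilon> > 0" "\<tau> > 0" "\<gamma> \<ge> 0"
    and l_add: "\<And>u v. u \<in> S \<Longrightarrow> v \<in> S \<Longrightarrow> l (u + v) = l u + l v"
    and l_scale: "\<And>c u. u \<in> S \<Longrightarrow> l (c *\<^sub>R u) = c * l u"
  shows "\<exists>!p. p \<in> S \<times> S \<and>
    (\<forall>\<nu>\<in>S. L2_inner \<Omega> (\<lambda>x. (fst p x - \<phi>c x) / \<tau>) \<nu> + \<epsilon> * dirichlet \<Omega> (snd p) \<nu> = 0) \<and>
    (\<forall>\<psi>\<in>S. inverse \<epsilon> * L2_inner \<Omega> (\<lambda>x. chi (fst p x) (\<phi>c x)) \<psi> + \<gamma> * dirichlet \<Omega> (fst p) \<psi> + l \<psi>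
       = L2_inner \<Omega> (snd p) \<psi>)"
proof -
  interpret m: psd_form S "L2_inner \<Omega>" by (rule L2_inner_psd_form[OF S])
  interpret a: psd_form S "dirichlet \<Omega>" by (rule dirichlet_psd_form[OF S])
  have pc: "piecewise_C1 v" and bb: "bounded_borel v" if "v \<in> S" for v
    using that S(2) piecewise_C1_bounded_borel by blast+
  have definite: "v = 0" if "v \<in> S" "L2_inner \<Omega> v v = 0" for v
    using L2_inner_definite pc that by blast
  define P where "P u = (LINT x:\<Omega>|lebesgue. chi_potential (u x) (\<phi>c x))" for u
  define P' where "P' u = L2_inner \<Omega> (\<lambda>x. chi (u x) (\<phi>c x))" for u
  \<comment> \<open>The discrete energy whose variation is the left side of the second
    equation.\<close>
  define F where "F u = inverse \<epsilon> * P u + \<gamma> / 2 * dirichlet \<Omega> u u + l u" for u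
  define F' where "F' u v = inverse \<epsilon> * P' u v + \<gamma> * dirichlet \<Omega> u v + l v" for u v
  have P'_add: "P' u (v + z) = P' u v + P' u z" if "u \<in> S" "v \<in> S" "z \<in> S" for u v z
    unfolding P'_def L2_inner_def using bb that \<phi>c
    by (simp add: distrib_left integral_domain_add bounded_borel_mult bounded_borel_chi)
  have P'_scale: "P' u (c *\<^sub>R v) = c * P' u v" for u v c
    unfolding P'_def L2_inner_def by (simp add: mult.left_commute)
  have F'_add: "F' u (v + z) = F' u v + F' u z" if "u \<in> S" "v \<in> S" "z \<in> S" for u v z
    using that by (simp add: F'_def P'_add a.add_right l_add algebra_simps)
  have F'_scale: "F' u (c *\<^sub>R v) = c * F' u v" if "u \<in> S" "v \<in> S" for u v c
    using that by (simp add: F'_def P'_scale a.scale_right l_scale algebra_simps)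
  have F'_diff: "F' u (v - z) = F' u v - F' u z" if "u \<in> S" "v \<in> S" "z \<in> S" for u v z
    using F'_add[of u v "(-1) *\<^sub>R z"] F'_scale[of u z "-1"] that m.mem_scale[of z "-1"] by simp
  have l_diff: "l (u - v) = l u - l v" if "u \<in> S" "v \<in> S" for u v
    using l_add[of u "(-1) *\<^sub>R v"] l_scale[of v "-1"] that m.mem_scale[of v "-1"] by simp
  have convex: "F u + F' u (v - u) \<le> F v" if u: "u \<in> S" and v: "v \<in> S" for u v
  proof -
    have "P u + P' u (v - u) \<le> P v"
      unfolding P_def P'_def using bb u v \<phi>c by (intro chi_energy_convex)
    then have "inverse \<epsilon> * (P u + P' u (v - u)) \<le> inverse \<epsilon> * P v"
      using pos by (intro mult_left_mono) auto
    moreover have "\<gamma> / 2 * dirichlet \<Omega> u u + \<gamma> * dirichlet \<Omega> u (v - u) \<le> \<gamma> / 2 * dirichlet \<Omega> v v"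
    proof -
      have "0 \<le> \<gamma> / 2 * dirichlet \<Omega> (v - u) (v - u)"
        using pos a.nonneg[of "v - u"] m.mem_diff[OF v u] by simp
      then show ?thesis
        using u v m.mem_diff[OF v u] a.sym[OF u v] by (simp add: a.diff_left a.diff_right algebra_simps)
    qed
    ultimately show ?thesis
      using l_diff[OF v u] by (simp add: F_def F'_def algebra_simps)
  qed
  have deriv: "((\<lambda>t. F (u + t *\<^sub>R v)) has_real_derivative F' u v) (at 0)" if u: "u \<in> S" and v: "v \<in> S" for u v
  proof -
    have quad: "dirichlet \<Omega> (u + t *\<^sub>R v) (u + t *\<^sub>R v)
        = dirichlet \<Omega> u u + 2 * t * dirichlet \<Omega> u v + t\<^sup>2 * dirichlet \<Omega> v v" for t
      using u v a.sym[OF u v]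
      by (simp add: a.add_left a.add_right a.scale_left a.scale_right a.mem_add a.mem_scale
          power2_eq_square algebra_simps)
    have lin: "l (u + t *\<^sub>R v) = l u + t * l v" for t
      using u v by (simp add: l_add l_scale m.mem_scale)
    have "((\<lambda>t. P (u + t *\<^sub>R v)) has_real_derivative P' u v) (at 0)"
      unfolding P_def P'_def by (rule chi_energy_deriv[OF bb[OF u] bb[OF v] bb[OF \<phi>c]])
    then show ?thesis
      unfolding F_def F'_def quad lin by (auto intro!: derivative_eq_intros)
  qed
  have cont: "continuous_on UNIV (\<lambda>c::nat \<Rightarrow> real. F (\<phi>c + (\<Sum>j<n. c j *\<^sub>R g j)))"
    if g: "\<And>j. j < n \<Longrightarrow> g j \<in> S" for n :: nat and g
  proof -
    let ?X = "\<lambda>c. \<phi>c + (\<Sum>j<n. c j *\<^sub>R g j)"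
    have sumS: "(\<Sum>j<n. c j *\<^sub>R g j) \<in> S" for c
      using g by (intro m.mem_sum) auto
    then have XS: "?X c \<in> S" for c using \<phi>c by (intro m.mem_add) auto
    have apply_sum: "(\<Sum>j<k. c j *\<^sub>R g j) x = (\<Sum>j<k. c j * g j x)" for c k x
      by (induction k) auto
    have "continuous_on UNIV (\<lambda>c. P (?X c))"
      unfolding P_def plus_fun_apply apply_sum using bb g \<phi>c by (intro chi_energy_continuous) auto
    \<comment> \<open>Expanding the form in both arguments leaves a polynomial in finitely many
      coordinates of \<open>c\<close>.\<close>
    moreover have expand: "dirichlet \<Omega> y (?X c) = dirichlet \<Omega> y \<phi>c + (\<Sum>j<n. c j * dirichlet \<Omega> y (g j))"
      if "y \<in> S" for y c
      using that \<phi>c g sumS[of c] a.sum_right[of "{..<n}" g y c] by (simp add: a.add_right)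
    have "dirichlet \<Omega> (?X c) (?X c) = dirichlet \<Omega> \<phi>c (?X c) + (\<Sum>j<n. c j * dirichlet \<Omega> (g j) (?X c))" for c
      using \<phi>c g sumS[of c] XS[of c] a.sum_left[of "{..<n}" g "?X c" c] by (simp add: a.add_left)
    then have quad: "dirichlet \<Omega> (?X c) (?X c) = dirichlet \<Omega> \<phi>c \<phi>c + (\<Sum>j<n. c j * dirichlet \<Omega> \<phi>c (g j))
        + (\<Sum>i<n. c i * (dirichlet \<Omega> (g i) \<phi>c + (\<Sum>j<n. c j * dirichlet \<Omega> (g i) (g j))))" for c
      using expand[OF \<phi>c, of c] expand[OF g, of _ c] by simp
    have "l (\<Sum>j<n. c j *\<^sub>R g j) = (\<Sum>j<n. c j * l (g j))" for c
      by (rule linear_on_subspace_sum[OF S(1) l_add l_scale g])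
    then have lin: "l (?X c) = l \<phi>c + (\<Sum>j<n. c j * l (g j))" for c
      using \<phi>c sumS[of c] by (simp add: l_add)
    ultimately show ?thesis
      unfolding F_def quad lin by (intro continuous_intros continuous_on_product_coordinates)
  qed
  have mono: "u = v" if u: "u \<in> S" and v: "v \<in> S" and le: "F' u (u - v) \<le> F' v (u - v)" for u v
  proof -
    have "0 \<le> \<gamma> * dirichlet \<Omega> (u - v) (u - v)"
      using pos a.nonneg m.mem_diff[OF u v] by simp
    then have "inverse \<epsilon> * P' u (u - v) \<le> inverse \<epsilon> * P' v (u - v)"
      using le a.diff_left[OF u v m.mem_diff[OF u v]] by (simp add: F'_def algebra_simps)
    then have "P' u (u - v) \<le> P' v (u - v)" using pos by simp
    then show ?thesis
      unfolding P'_def by (rule chi_strictly_monotone_operator[OF pc[OF u] pc[OF v] bb[OF \<phi>c]])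
  qed
  have "\<tau> * \<epsilon> > 0" using pos by simp
  \<comment> \<open>Clearing the denominator \<tau> brings the equation into saddle point form with
    parameter \<open>\<tau> * \<epsilon>\<close>.\<close>
  have first: "(L2_inner \<Omega> (\<lambda>x. (x1 x - \<phi>c x) / \<tau>) z + \<epsilon> * dirichlet \<Omega> y z = 0)
      \<longleftrightarrow> L2_inner \<Omega> (x1 - \<phi>c) z + (\<tau> * \<epsilon>) * dirichlet \<Omega> y z = 0" for x1 y z
  proof -
    have "L2_inner \<Omega> (\<lambda>x. (x1 x - \<phi>c x) / \<tau>) z = L2_inner \<Omega> (x1 - \<phi>c) z / \<tau>"
      unfolding L2_inner_def by simp
    then have "L2_inner \<Omega> (\<lambda>x. (x1 x - \<phi>c x) / \<tau>) z + \<epsilon> * dirichlet \<Omega> y z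
        = (L2_inner \<Omega> (x1 - \<phi>c) z + (\<tau> * \<epsilon>) * dirichlet \<Omega> y z) / \<tau>"
      using pos by (simp only:) (simp add: add_divide_distrib)
    then show ?thesis using pos by simp
  qed
  have unique: "x1 = x2 \<and> y1 = y2"
    if "x1 \<in> S" "x2 \<in> S" "y1 \<in> S" "y2 \<in> S"
      "\<forall>z\<in>S. L2_inner \<Omega> (x1 - \<phi>c) z + (\<tau> * \<epsilon>) * dirichlet \<Omega> y1 z = 0" "\<forall>z\<in>S. F' x1 z = L2_inner \<Omega> y1 z"
      "\<forall>z\<in>S. L2_inner \<Omega> (x2 - \<phi>c) z + (\<tau> * \<epsilon>) * dirichlet \<Omega> y2 z = 0" "\<forall>z\<in>S. F' x2 z = L2_inner \<Omega> y2 z"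
    for x1 x2 y1 y2
    by (rule saddle_point_system_unique[OF m.psd_form_axioms definite a.psd_form_axioms
          \<open>\<tau> * \<epsilon> > 0\<close> \<phi>c F'_diff mono that])
  obtain x y where "x \<in> S" "y \<in> S"
      "\<forall>z\<in>S. L2_inner \<Omega> (x - \<phi>c) z + (\<tau> * \<epsilon>) * dirichlet \<Omega> y z = 0" "\<forall>z\<in>S. F' x z = L2_inner \<Omega> y z"
    using saddle_point_system_solvable[where F = F and F' = F', OF m.psd_form_axioms definite
        a.psd_form_axioms fin \<open>\<tau> * \<epsilon> > 0\<close> \<phi>c F'_add F'_scale convex deriv cont] by blast
  then have "\<exists>!p. p \<in> S \<times> S \<and> (\<forall>z\<in>S. L2_inner \<Omega> (fst p - \<phi>c) z + (\<tau> * \<epsilon>) * dirichlet \<Omega> (snd p) z = 0)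
      \<and> (\<forall>z\<in>S. F' (fst p) z = L2_inner \<Omega> (snd p) z)"
    using unique by (intro ex1I[of _ "(x, y)"]) auto
  then show ?thesis unfolding first F'_def P'_def .
qed

end

section \<open>Finite element functions\<close>

lemma finite_multi_indices: "finite {\<alpha> :: 'n::finite \<Rightarrow> nat. (\<Sum>i\<in>UNIV. \<alpha> i) \<le> q}"
proof (rule finite_subset)
  show "{\<alpha> :: 'n \<Rightarrow> nat. (\<Sum>i\<in>UNIV. \<alpha> i) \<le> q} \<subseteq> PiE UNIV (\<lambda>_. {..q})"
  proof
    fix \<alpha> :: "'n \<Rightarrow> nat" assume "\<alpha> \<in> {\<alpha>. (\<Sum>i\<in>UNIV. \<alpha> i) \<le> q}"
    then have "\<alpha> i \<le> q" for i
      using member_le_sum[of i UNIV \<alpha>] by simp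
    then show "\<alpha> \<in> PiE UNIV (\<lambda>_. {..q})" by auto
  qed
qed (simp add: finite_PiE)

lemma polys_C1_function: "p \<in> polys q \<Longrightarrow> C1_function p"
  unfolding polys_def
  by (auto intro!: C1_function_sum C1_function_mult C1_function_prod C1_function_power
      C1_function_component C1_function_const)

lemma polys_add: "p \<in> polys q \<Longrightarrow> r \<in> polys q \<Longrightarrow> (\<lambda>x. p x + r x) \<in> polys q"
proof -
  assume "p \<in> polys q" "r \<in> polys q"
  then obtain c d where "p = (\<lambda>x. \<Sum>\<alpha> | (\<Sum>i\<in>UNIV. \<alpha> i) \<le> q. c \<alpha> * (\<Prod>i\<in>UNIV. (x $ i) ^ \<alpha> i))"
    "r = (\<lambda>x. \<Sum>\<alpha> | (\<Sum>i\<in>UNIV. \<alpha> i) \<le> q. d \<alpha> * (\<Prod>i\<in>UNIV. (x $ i) ^ \<alpha> i))"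
    unfolding polys_def by blast
  then show ?thesis
    unfolding polys_def
    by (intro CollectI exI[of _ "\<lambda>\<alpha>. c \<alpha> + d \<alpha>"]) (simp add: sum.distrib distrib_right)
qed

lemma polys_scale: "p \<in> polys q \<Longrightarrow> (\<lambda>x. a * p x) \<in> polys q"
proof -
  assume "p \<in> polys q"
  then obtain c where "p = (\<lambda>x. \<Sum>\<alpha> | (\<Sum>i\<in>UNIV. \<alpha> i) \<le> q. c \<alpha> * (\<Prod>i\<in>UNIV. (x $ i) ^ \<alpha> i))"
    unfolding polys_def by blast
  then show ?thesis
    unfolding polys_def
    by (intro CollectI exI[of _ "\<lambda>\<alpha>. a * c \<alpha>"]) (simp add: sum_distrib_left mult.assoc)
qed

lemma polys_zero: "(\<lambda>x. 0) \<in> polys q"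
  unfolding polys_def by (intro CollectI exI[of _ "\<lambda>\<alpha>. 0"]) simp

lemma subspace_fe_space: "subspace (fe_space \<Omega> \<T> q)"
proof (rule subspaceI)
  show "0 \<in> fe_space \<Omega> \<T> q"
    by (auto simp: fe_space_def zero_fun_def intro!: bexI[of _ "\<lambda>x. 0"] polys_zero)
  fix u v and c :: real assume u: "u \<in> fe_space \<Omega> \<T> q"
  show "c *\<^sub>R u \<in> fe_space \<Omega> \<T> q"
    unfolding fe_space_def
  proof (intro CollectI conjI ballI)
    show "continuous_on \<Omega> (c *\<^sub>R u)"
      using u unfolding scaleR_fun_def fe_space_def by (auto intro: continuous_intros)
    fix K assume "K \<in> \<T>"
    then obtain p where "p \<in> polys q" "\<forall>x\<in>K \<inter> \<Omega>. u x = p x" using u unfolding fe_space_def by auto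
    then show "\<exists>p\<in>polys q. \<forall>x\<in>K \<inter> \<Omega>. (c *\<^sub>R u) x = p x"
      by (intro bexI[of _ "\<lambda>x. c * p x"]) (auto intro: polys_scale)
  qed (use u in \<open>auto simp: fe_space_def\<close>)
  assume v: "v \<in> fe_space \<Omega> \<T> q"
  show "u + v \<in> fe_space \<Omega> \<T> q"
    unfolding fe_space_def
  proof (intro CollectI conjI ballI)
    show "continuous_on \<Omega> (u + v)"
      using u v unfolding plus_fun_def fe_space_def by (auto intro: continuous_intros)
    fix K assume K: "K \<in> \<T>"
    then obtain p where p: "p \<in> polys q" "\<forall>x\<in>K \<inter> \<Omega>. u x = p x" using u unfolding fe_space_def by auto
    obtain r where r: "r \<in> polys q" "\<forall>x\<in>K \<inter> \<Omega>. v x = r x" using v K unfolding fe_space_def by auto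
    show "\<exists>p\<in>polys q. \<forall>x\<in>K \<inter> \<Omega>. (u + v) x = p x"
      using p r by (intro bexI[of _ "\<lambda>x. p x + r x"]) (auto intro: polys_add)
  qed (use u v in \<open>auto simp: fe_space_def\<close>)
qed

lemma sum_fun_apply: "(\<Sum>i\<in>I. f i) x = (\<Sum>i\<in>I. f i x)"
  for f :: "'i \<Rightarrow> 'a \<Rightarrow> 'b::real_vector"
  by (induction I rule: infinite_finite_induct) auto

text \<open>Every point of the domain is assigned to one of the elements containing it, which makes the
  monomials restricted to the resulting disjoint pieces a spanning set.\<close>

lemma fe_space_finite_span:
  assumes "finite \<T>" "\<Omega> \<subseteq> \<Union>\<T>"
  obtains B where "finite B" "fe_space \<Omega> \<T> q \<subseteq> span B"
proof -
  define k where "k x = (SOME K. K \<in> \<T> \<and> x \<in> K)" for x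
  have k: "k x \<in> \<T>" "x \<in> k x" if "x \<in> \<Omega>" for x
  proof -
    have "\<exists>K. K \<in> \<T> \<and> x \<in> K" using that assms(2) by blast
    from someI_ex[OF this] show "k x \<in> \<T>" "x \<in> k x" by (auto simp: k_def)
  qed
  define A where "A = {\<alpha> :: 'a \<Rightarrow> nat. (\<Sum>i\<in>UNIV. \<alpha> i) \<le> q}"
  define e :: "(real^'a) set \<Rightarrow> ('a \<Rightarrow> nat) \<Rightarrow> real^'a \<Rightarrow> real"
    where "e K \<alpha> x = (if x \<in> \<Omega> \<and> k x = K then \<Prod>i\<in>UNIV. (x $ i) ^ \<alpha> i else 0)" for K \<alpha> x
  define B where "B = (\<lambda>(K, \<alpha>). e K \<alpha>) ` (\<T> \<times> A)"
  show thesis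
  proof
    show "finite B" using assms(1) finite_multi_indices by (auto simp: B_def A_def)
    show "fe_space \<Omega> \<T> q \<subseteq> span B"
    proof
      fix v assume v: "v \<in> fe_space \<Omega> \<T> q"
      have "\<forall>K\<in>\<T>. \<exists>c. \<forall>x\<in>K \<inter> \<Omega>. v x = (\<Sum>\<alpha>\<in>A. c \<alpha> * (\<Prod>i\<in>UNIV. (x $ i) ^ \<alpha> i))"
      proof
        fix K assume "K \<in> \<T>"
        then obtain p where "p \<in> polys q" "\<forall>x\<in>K \<inter> \<Omega>. v x = p x" using v unfolding fe_space_def by auto
        then show "\<exists>c. \<forall>x\<in>K \<inter> \<Omega>. v x = (\<Sum>\<alpha>\<in>A. c \<alpha> * (\<Prod>i\<in>UNIV. (x $ i) ^ \<alpha> i))"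
          unfolding polys_def A_def by auto
      qed
      from bchoice[OF this] obtain c
        where c: "\<And>K x. K \<in> \<T> \<Longrightarrow> x \<in> K \<inter> \<Omega> \<Longrightarrow> v x = (\<Sum>\<alpha>\<in>A. c K \<alpha> * (\<Prod>i\<in>UNIV. (x $ i) ^ \<alpha> i))"
        by auto
      have "v = (\<Sum>K\<in>\<T>. \<Sum>\<alpha>\<in>A. c K \<alpha> *\<^sub>R e K \<alpha>)"
      proof
        fix x
        show "v x = (\<Sum>K\<in>\<T>. \<Sum>\<alpha>\<in>A. c K \<alpha> *\<^sub>R e K \<alpha>) x"
        proof (cases "x \<in> \<Omega>")
          case True
          have "(\<Sum>K\<in>\<T>. \<Sum>\<alpha>\<in>A. c K \<alpha> *\<^sub>R e K \<alpha>) x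
              = (\<Sum>K\<in>\<T>. if k x = K then \<Sum>\<alpha>\<in>A. c K \<alpha> * (\<Prod>i\<in>UNIV. (x $ i) ^ \<alpha> i) else 0)"
            unfolding sum_fun_apply using True by (intro sum.cong) (auto simp: e_def)
          also have "\<dots> = v x"
            using c[OF k(1)[OF True], of x] k[OF True] True assms(1) by simp
          finally show ?thesis by simp
        qed (use v in \<open>auto simp: sum_fun_apply e_def fe_space_def\<close>)
      qed
      also have "\<dots> \<in> span B"
        by (intro span_sum span_scale span_base) (auto simp: B_def)
      finally show "v \<in> span B" .
    qed
  qed
qed

theorem theorem2p1:
  fixes \<Omega> :: "(real^'n) set"
    and H :: "real set" and \<T> :: "real \<Rightarrow> (real^'n) set set"
    and h \<epsilon> \<tau> Tfin :: real
    and M q :: nat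
    and S :: "(real^'n \<Rightarrow> real) set"
  assumes "CARD('n) = 2 \<or> CARD('n) = 3"
    and "polyhedral_domain \<Omega>"
    and "mesh_family \<Omega> H \<T>"
    and "h \<in> H"
    and "q \<ge> 1"
    and "Tfin > 0" and "M > 0" and "\<tau> = Tfin / real M"
    and "\<epsilon> > 0"
    and "S = fe_space \<Omega> (\<T> h) q"
  shows "(\<forall>\<phi>0\<in>S. \<forall>\<mu>0\<in>S.
            \<exists>!(p :: (real^'n \<Rightarrow> real) \<times> (real^'n \<Rightarrow> real)).
              p \<in> S \<times> S \<and> first_step \<Omega> S \<epsilon> \<tau> \<phi>0 \<mu>0 (fst p) (snd p)) \<and>
         (\<forall>m \<phi>. 1 \<le> m \<and> m \<le> M - 1 \<and> \<phi> m \<in> S \<and> \<phi> (m - 1) \<in> S \<longrightarrow>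
            (\<exists>!(p :: (real^'n \<Rightarrow> real) \<times> (real^'n \<Rightarrow> real)).
              p \<in> S \<times> S \<and> multi_step \<Omega> S \<epsilon> \<tau> (\<phi> m) (\<phi> (m - 1)) (fst p) (snd p)))"
proof -
  have mesh: "conforming_mesh \<Omega> (\<T> h)"
    using assms by (auto simp: mesh_family_def)
  have simplex: "int CARD('n) simplex K" if "K \<in> \<T> h" for K
    using mesh that by (auto simp: conforming_mesh_def)
  interpret convex_mesh \<Omega> "\<T> h"
  proof
    show "open \<Omega>" "bounded \<Omega>" using assms(2) by (auto simp: polyhedral_domain_def)
    show "finite (\<T> h)" using mesh by (auto simp: conforming_mesh_def triangulation_def)
    show "compact K" "convex K" "interior K \<subseteq> \<Omega>" if "K \<in> \<T> h" for K
      using mesh that compact_simplex[OF simplex] convex_simplex[OF simplex]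
      by (auto simp: conforming_mesh_def)
    show "\<Union>(\<T> h) = closure \<Omega>" using mesh by (auto simp: conforming_mesh_def)
  qed
  have S: "subspace S" using assms subspace_fe_space by simp
  have pc: "S \<subseteq> Collect piecewise_C1"
  proof
    fix v assume v: "v \<in> S"
    have "\<exists>p. C1_function p \<and> (\<forall>x\<in>K \<inter> \<Omega>. v x = p x)" if "K \<in> \<T> h" for K
      using v that assms polys_C1_function unfolding fe_space_def by fast
    then show "v \<in> Collect piecewise_C1"
      using v assms by (simp add: piecewise_C1_def fe_space_def)
  qed
  obtain B where B: "finite B" "S \<subseteq> span B"
    using fe_space_finite_span[of "\<T> h" \<Omega> q] finite_mesh Union_mesh closure_subset assms by metis
  have "\<tau> > 0" using assms by simp
  interpret m: psd_form S "L2_inner \<Omega>" by (rule L2_inner_psd_form[OF S pc])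
  interpret a: psd_form S "dirichlet \<Omega>" by (rule dirichlet_psd_form[OF S pc])
  have comb: "(\<lambda>x. c * u x + d * v x) = c *\<^sub>R u + d *\<^sub>R v" for c d and u v :: "real^'n \<Rightarrow> real"
    by (simp add: fun_eq_iff)
  have dcomb: "dirichlet \<Omega> (\<lambda>x. c * u x + d * v x) \<psi> = c * dirichlet \<Omega> u \<psi> + d * dirichlet \<Omega> v \<psi>"
    if "u \<in> S" "v \<in> S" "\<psi> \<in> S" for c d u v \<psi>
    unfolding comb using that by (simp add: a.add_left a.scale_left a.mem_scale)
  show ?thesis
  proof (intro conjI ballI allI impI)
    fix \<phi>0 \<mu>0 assume \<phi>0: "\<phi>0 \<in> S" and \<mu>0: "\<mu>0 \<in> S"
    \<comment> \<open>The average in the diffusion term splits: the half with the unknown becomes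
      \<gamma>, while the half with \<open>\<phi>0\<close> is known data.\<close>
    define l where "l \<psi> = - (inverse \<epsilon> * L2_inner \<Omega> \<phi>0 \<psi>) + \<tau> / 2 * dirichlet \<Omega> \<mu>0 \<psi>
      + \<epsilon> / 2 * dirichlet \<Omega> \<phi>0 \<psi>" for \<psi>
    have l: "l (u + v) = l u + l v" "l (c *\<^sub>R u) = c * l u" if "u \<in> S" "v \<in> S" for u v c
      using that \<phi>0 \<mu>0 unfolding l_def
      by (simp_all add: m.add_right a.add_right m.scale_right a.scale_right algebra_simps)
    \<comment> \<open>Separating the joint quantifier over \<nu> and \<psi> requires a member of
      \<open>S\<close>, supplied by \<open>m.mem_zero\<close>. The equivalence holds only for
      \<open>u\<close> in \<open>S\<close>, where the form is linear, hence \<open>conj_cong\<close>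
      below.\<close>
    have "first_step \<Omega> S \<epsilon> \<tau> \<phi>0 \<mu>0 u \<mu> \<longleftrightarrow>
        (\<forall>\<nu>\<in>S. L2_inner \<Omega> (\<lambda>x. (u x - \<phi>0 x) / \<tau>) \<nu> + \<epsilon> * dirichlet \<Omega> \<mu> \<nu> = 0) \<and>
        (\<forall>\<psi>\<in>S. inverse \<epsilon> * L2_inner \<Omega> (\<lambda>x. chi (u x) (\<phi>0 x)) \<psi> + \<epsilon> / 2 * dirichlet \<Omega> u \<psi> + l \<psi>
           = L2_inner \<Omega> \<mu> \<psi>)" if "u \<in> S" for u \<mu>
      using dcomb[OF that \<phi>0, of _ "1/2" "1/2"] m.mem_zero
      unfolding first_step_def l_def by (auto simp: algebra_simps)
    then show "\<exists>!p. p \<in> S \<times> S \<and> first_step \<Omega> S \<epsilon> \<tau> \<phi>0 \<mu>0 (fst p) (snd p)"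
      using semi_implicit_step_uniquely_solvable[OF S pc B \<phi>0 \<open>\<epsilon> > 0\<close> \<open>\<tau> > 0\<close>, of "\<epsilon> / 2" l] l \<open>\<epsilon> > 0\<close>
      by (simp add: mem_Times_iff cong: conj_cong)
  next
    fix k and \<phi> :: "nat \<Rightarrow> real^'n \<Rightarrow> real"
    assume asm: "1 \<le> k \<and> k \<le> M - 1 \<and> \<phi> k \<in> S \<and> \<phi> (k - 1) \<in> S"
    define \<phi>c where "\<phi>c = \<phi> k"
    define \<phi>p where "\<phi>p = \<phi> (k - 1)"
    have \<phi>c: "\<phi>c \<in> S" and \<phi>p: "\<phi>p \<in> S" using asm by (auto simp: \<phi>c_def \<phi>p_def)
    define w where "w = (\<lambda>x. 3/2 * \<phi>c x - 1/2 * \<phi>p x)"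
    have "w = (3/2) *\<^sub>R \<phi>c - (1/2) *\<^sub>R \<phi>p" by (simp add: w_def fun_eq_iff)
    then have w: "w \<in> S" using \<phi>c \<phi>p by (simp add: m.mem_diff m.mem_scale)
    \<comment> \<open>Of the diffusion weights 3/4 and 1/4 only the latter, on the older iterate, is
      explicit.\<close>
    define l where "l \<psi> = - (inverse \<epsilon> * L2_inner \<Omega> w \<psi>) + \<epsilon> / 4 * dirichlet \<Omega> \<phi>p \<psi>" for \<psi>
    have l: "l (u + v) = l u + l v" "l (c *\<^sub>R u) = c * l u" if "u \<in> S" "v \<in> S" for u v c
      using that \<phi>p w unfolding l_def
      by (simp_all add: m.add_right a.add_right m.scale_right a.scale_right algebra_simps)
    have "multi_step \<Omega> S \<epsilon> \<tau> \<phi>c \<phi>p u \<mu> \<longleftrightarrow>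
        (\<forall>\<nu>\<in>S. L2_inner \<Omega> (\<lambda>x. (u x - \<phi>c x) / \<tau>) \<nu> + \<epsilon> * dirichlet \<Omega> \<mu> \<nu> = 0) \<and>
        (\<forall>\<psi>\<in>S. inverse \<epsilon> * L2_inner \<Omega> (\<lambda>x. chi (u x) (\<phi>c x)) \<psi> + 3 * \<epsilon> / 4 * dirichlet \<Omega> u \<psi> + l \<psi>
           = L2_inner \<Omega> \<mu> \<psi>)" if "u \<in> S" for u \<mu>
      using dcomb[OF that \<phi>p, of _ "3/4" "1/4"] m.mem_zero
      unfolding multi_step_def l_def w_def[symmetric] by (auto simp: algebra_simps)
    then show "\<exists>!p. p \<in> S \<times> S \<and> multi_step \<Omega> S \<epsilon> \<tau> (\<phi> k) (\<phi> (k - 1)) (fst p) (snd p)"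
      using semi_implicit_step_uniquely_solvable[OF S pc B \<phi>c \<open>\<epsilon> > 0\<close> \<open>\<tau> > 0\<close>, of "3 * \<epsilon> / 4" l] l \<open>\<epsilon> > 0\<close>
      unfolding \<phi>c_def[symmetric] \<phi>p_def[symmetric]
      by (simp add: mem_Times_iff cong: conj_cong)
  qed
qed

end
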